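(* Let $c>0$ and $n\geq1$. The reverse Santaló inequality $\mathrm{IS}_n(c)$ holds if and only if \[ K(\nu_1|\mathrm{Leb})+K(\nu_2|\mathrm{Leb})\geq n\log c-\mathcal{T}(\nu_1,\nu_2) \] for all $\nu_1,\nu_2\in\mathcal{P}_1(\mathbb{R}^n)$ (resp. if and only if this inequality holds for all compactly supported probability measures $\nu_1,\nu_2$ on $\mathbb{R}^n$). In the case of the reverse Santaló inequality $\mathrm{IS}_{n,u}(c)$ (resp. $\mathrm{IS}_{n,s}(c)$), the same statement holds with the extra condition that $\nu_1,\nu_2$ belong to $\mathcal{P}_{u,1}(\mathbb{R}^n)$ (resp. $\mathcal{P}_{s,1}(\mathbb{R}^n)$).
   Context: $\mathcal{F}(\mathbb{R}^n)$ is the set of lower semicontinuous convex functions $f:\mathbb{R}^n\to\mathbb{R}\cup\{+\infty\}$ finite at at least one point, and $f^*(y)=\sup_{x\in\mathbb{R}^n}\{x\cdot y-f(x)\}$. Functions/measures are symmetric if invariant under $x\mapsto-x$, unconditional if invariant under all maps $x\mapsto(\varepsilon_1x_1,\ldots,\varepsilon_nx_n)$, $\varepsilon\in\{-1,1\}^n$; $\mathcal{F}_s(\mathbb{R}^n),\mathcal{F}_u(\mathbb{R}^n)$ are the symmetric, resp. unconditional, elements of $\mathcal{F}(\mathbb{R}^n)$. $\mathcal{P}_1(\mathbb{R}^n)$ is the set of Borel probability measures with finite first moment, and $\mathcal{P}_{s,1}(\mathbb{R}^n),\mathcal{P}_{u,1}(\mathbb{R}^n)$ its symmetric, resp. unconditional,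 elements. $\mathrm{IS}_n(c)$ holds if $\int e^{-f}\,dx\int e^{-f^*}\,dx\geq c^n$ for all $f\in\mathcal{F}(\mathbb{R}^n)$ with $0<\int e^{-f}\,dx$ and $0<\int e^{-f^*}\,dx$; $\mathrm{IS}_{n,s}(c)$ (resp. $\mathrm{IS}_{n,u}(c)$) holds if the same is true for all such $f\in\mathcal{F}_s(\mathbb{R}^n)$ (resp. $\mathcal{F}_u(\mathbb{R}^n)$). For $\nu\in\mathcal{P}_1(\mathbb{R}^n)$, \[ K(\nu|\mathrm{Leb})=\sup_{f\in L^1(\nu)\cap\mathcal{F}(\mathbb{R}^n)}\left\{\int(-f)\,d\nu+\log\int e^{-f^*}\,dx\right\}. \] For $\nu_1,\nu_2\in\mathcal{P}_1(\mathbb{R}^n)$, \[ \mathcal{T}(\nu_1,\nu_2)=\inf_{f\in\mathcal{F}(\mathbb{R}^n)}\left\{\int f\,d\nu_1+\int f^*\,d\nu_2\right\}, \] the integrals being well defined in $\mathbb{R}\cup\{+\infty\}$. *)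

theory Defs
  imports "HOL-Probability.Probability"
begin

text \<open>In \<^typ>\<open>ereal\<close> one has \<open>0 * \<infinity> = 0\<close>, so the endpoint cases of the convexity inequality
  below are trivially true, as they should be.\<close>

definition lsc_convex :: "(real^'n \<Rightarrow> ereal) set" where
  "lsc_convex = {f.
     (\<forall>x. f x \<noteq> -\<infinity>) \<and> (\<exists>x. f x \<noteq> \<infinity>) \<and>
     (\<forall>x. f x \<le> Liminf (at x) f) \<and>
     (\<forall>x y u v. u \<ge> 0 \<and> v \<ge> 0 \<and> u + v = 1 \<longrightarrow>
        f (u *\<^sub>R x + v *\<^sub>R y) \<le> ereal u * f x + ereal v * f y)}"

definition legendre :: "(real^'n \<Rightarrow> ereal) \<Rightarrow> real^'n \<Rightarrow> ereal" where
  "legendre f y = (SUP x. ereal (x \<bullet> y) - f x)"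

definition sign_change :: "('n \<Rightarrow> real) \<Rightarrow> real^'n \<Rightarrow> real^'n" where
  "sign_change \<epsilon> x = (\<chi> i. \<epsilon> i * x $ i)"

definition lsc_convex_sym :: "(real^'n \<Rightarrow> ereal) set" where
  "lsc_convex_sym = {f \<in> lsc_convex. \<forall>x. f (- x) = f x}"

definition lsc_convex_uncond :: "(real^'n \<Rightarrow> ereal) set" where
  "lsc_convex_uncond =
     {f \<in> lsc_convex. \<forall>\<epsilon> \<in> UNIV \<rightarrow> {-1, 1}. \<forall>x. f (sign_change \<epsilon> x) = f x}"

definition exp_ereal :: "ereal \<Rightarrow> ennreal" where
  "exp_ereal x =
     (if x = \<infinity> then \<infinity> else if x = -\<infinity> then 0 else ennreal (exp (real_of_ereal x)))"

definition log_ennreal :: "ennreal \<Rightarrow> ereal" where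
  "log_ennreal z = (if z = 0 then -\<infinity> else if z = \<infinity> then \<infinity> else ereal (ln (enn2real z)))"

text \<open>\<^const>\<open>e2ennreal\<close> truncates negative values to \<open>0\<close>, so the integral below is the difference
  of the integrals of the positive and of the negative part. It is only meaningful if one of
  them is finite (in \<^typ>\<open>ereal\<close>, \<open>\<infinity> - \<infinity> = \<infinity>\<close>). For a lower semicontinuous convex function and a
  measure with finite first moment the negative part always has a finite integral, because such
  a function has an affine minorant.\<close>

definition ereal_integral :: "'a measure \<Rightarrow> ('a \<Rightarrow> ereal) \<Rightarrow> ereal" where
  "ereal_integral \<nu> f =
     enn2ereal (\<integral>\<^sup>+ x. e2ennreal (f x) \<partial>\<nu>) - enn2ereal (\<integral>\<^sup>+ x. e2ennreal (- f x) \<partial>\<nu>)"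

definition ereal_L1 :: "'a measure \<Rightarrow> ('a \<Rightarrow> ereal) set" where
  "ereal_L1 \<nu> = {f \<in> borel_measurable \<nu>. (\<integral>\<^sup>+ x. e2ennreal \<bar>f x\<bar> \<partial>\<nu>) < \<infinity>}"

definition exp_mass :: "(real^'n \<Rightarrow> ereal) \<Rightarrow> ennreal" where
  "exp_mass f = (\<integral>\<^sup>+ x. exp_ereal (- f x) \<partial>lborel)"

definition reverse_santalo :: "(real^'n \<Rightarrow> ereal) set \<Rightarrow> real \<Rightarrow> bool" where
  "reverse_santalo \<F> c \<longleftrightarrow>
     (\<forall>f \<in> \<F>. 0 < exp_mass f \<and> 0 < exp_mass (legendre f) \<longrightarrow>
        exp_mass f * exp_mass (legendre f) \<ge> ennreal (c ^ CARD('n)))"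

definition borel_prob :: "(real^'n) measure set" where
  "borel_prob = {\<nu>. sets \<nu> = sets borel \<and> prob_space \<nu>}"

definition prob1 :: "(real^'n) measure set" where
  "prob1 = {\<nu> \<in> borel_prob. integrable \<nu> (\<lambda>x. norm x)}"

definition prob1_sym :: "(real^'n) measure set" where
  "prob1_sym = {\<nu> \<in> prob1. distr \<nu> borel uminus = \<nu>}"

definition prob1_uncond :: "(real^'n) measure set" where
  "prob1_uncond = {\<nu> \<in> prob1. \<forall>\<epsilon> \<in> UNIV \<rightarrow> {-1, 1}. distr \<nu> borel (sign_change \<epsilon>) = \<nu>}"

definition measure_support :: "'a::topological_space measure \<Rightarrow> 'a set" where
  "measure_support \<nu> = {x. \<forall>U. open U \<and> x \<in> U \<longrightarrow> emeasure \<nu> U > 0}"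

definition prob_compact :: "(real^'n) measure set" where
  "prob_compact = {\<nu> \<in> borel_prob. compact (measure_support \<nu>)}"

definition K_Leb :: "(real^'n) measure \<Rightarrow> ereal" where
  "K_Leb \<nu> = (SUP f \<in> ereal_L1 \<nu> \<inter> lsc_convex.
      ereal_integral \<nu> (\<lambda>x. - f x) + log_ennreal (exp_mass (legendre f)))"

definition transport :: "(real^'n) measure \<Rightarrow> (real^'n) measure \<Rightarrow> ereal" where
  "transport \<nu>\<^sub>1 \<nu>\<^sub>2 =
     (INF f \<in> lsc_convex. ereal_integral \<nu>\<^sub>1 f + ereal_integral \<nu>\<^sub>2 (legendre f))"

text \<open>No \<open>\<infinity> - \<infinity>\<close> occurs here for measures with finite first moment: then \<^term>\<open>K_Leb \<nu> > -\<infinity>\<close>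
  (test with \<open>f x = norm x\<close>), and \<open>transport \<nu>\<^sub>1 \<nu>\<^sub>2\<close> is bounded below by the inner product of
  the two barycentres.\<close>

definition entropy_transport_ineq ::
    "real \<Rightarrow> (real^'n) measure \<Rightarrow> (real^'n) measure \<Rightarrow> bool" where
  "entropy_transport_ineq c \<nu>\<^sub>1 \<nu>\<^sub>2 \<longleftrightarrow>
     K_Leb \<nu>\<^sub>1 + K_Leb \<nu>\<^sub>2 \<ge> ereal (real CARD('n) * ln c) - transport \<nu>\<^sub>1 \<nu>\<^sub>2"

end

theory Submission
  imports Defs
begin

text \<open>Write \<open>f\<^sup>*\<close> for \<^term>\<open>legendre f\<close> and \<open>m f\<close> for \<^term>\<open>exp_mass f\<close>. The functional
\<open>f \<mapsto> log (m f\<^sup>*)\<close> is concave, and \<open>K_Leb \<nu>\<close> is, up to signs, its conjugate: it is the least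
constant with \<open>log (m f\<^sup>*) \<le> \<integral> f d\<nu> + K_Leb \<nu>\<close> for all \<open>\<nu>\<close>-integrable convex
\<open>f\<close>. The theorem is the duality between an inequality for functions and the inequality for their
conjugates.

From functions to measures, apply the definition of \<open>K_Leb\<close> to \<open>f\<close> and \<open>\<nu>\<^sub>1\<close> and to \<open>f\<^sup>*\<close> and
\<open>\<nu>\<^sub>2\<close>. The sum is at least \<open>log (m f \<cdot> m f\<^sup>*) - (\<integral> f d\<nu>\<^sub>1 + \<integral> f\<^sup>* d\<nu>\<^sub>2)\<close>, and the infimum over \<open>f\<close>
of the bracket is the transport cost. Two points need care. The reverse Santalo inequality says
nothing when \<open>m f\<close> or \<open>m f\<^sup>*\<close> vanishes; but then, for \<open>f\<close> of finite cost, one of the measures is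
carried by a hyperplane, and its \<open>K_Leb\<close> is infinite
(\<open>K_Leb_infinite_if_exp_mass_0\<close>). And \<open>f\<close> has no symmetry although the measures have; it is replaced by the transform of the symmetric mean of \<open>f\<^sup>*\<close>, which does not
increase either integral.

From measures to functions, for \<open>f\<close> with positive and finite \<open>m f\<close> and \<open>m f\<^sup>*\<close>
and for \<open>\<eta> > log (m f\<^sup>*)\<close> one needs a compactly supported
\<open>\<nu>\<close> with \<open>K_Leb \<nu> + \<integral> f d\<nu> \<le> \<eta>\<close>, that is, an almost tangent to the concave functional at \<open>f\<close>
(\<open>K_Leb_upper_bound\<close>). Applied to \<open>f\<close> and to \<open>f\<^sup>*\<close>, whose transform is \<open>f\<close> again
(\<open>fenchel_moreau\<close>), this yields \<open>log (m f \<cdot> m f\<^sup>*) \<ge> n log c\<close> in the limit.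

The measure \<open>\<nu>\<close> is discrete. The transform \<open>f\<^sup>*\<close> is a limit of finite maxima
\<open>\<phi>(y) = max {x \<bullet> y - f x | x \<in> S}\<close>, and the masses converge as well, because the origin
lies in the interior of the domain of \<open>f\<close> whenever \<open>m f\<^sup>*\<close> is positive and finite, and this makes
\<open>\<phi>\<close> coercive for suitable \<open>S\<close>
(\<open>polyhedral_approximation\<close>). For a fixed finite \<open>S\<close> the mass is a log-concave function of the
finitely many values of \<open>f\<close> on \<open>S\<close>, by the Prekopa-Leindler inequality. Its logarithmic gradient
is a probability vector on \<open>S\<close>, the masses of the cells on which the several affine functions
are maximal under the density proportional to \<open>exp (- \<phi>)\<close>; this vector is \<open>\<nu>\<close>, and concavity
says that the tangent lies above the functional (\<open>max_affine_mass_tangent\<close>). Only the midpoint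
form of Prekopa-Leindler is used, in which squares replace real powers: iterating it along
\<open>t = 1 / 2 ^ k\<close> already determines the derivative at \<open>t = 0\<close>. The symmetric classes follow by averaging \<open>\<nu>\<close>
over the group of sign changes.\<close>

section \<open>The midpoint Prekopa-Leindler inequality\<close>

text \<open>Restricted to the balls \<open>cball 0 n\<close>, Lebesgue measure is finite and hence inner regular, and the
balls exhaust the line.\<close>

lemma emeasure_lborel_SUP_compact:
  fixes A :: "real set"
  assumes [measurable]: "A \<in> sets borel"
  shows "emeasure lborel A = (SUP K\<in>{K. K \<subseteq> A \<and> compact K}. emeasure lborel K)"
proof (rule antisym)
  let ?S = "SUP K\<in>{K. K \<subseteq> A \<and> compact K}. emeasure lborel K"
  have bounded_part: "emeasure lborel (A \<inter> cball 0 (real n)) \<le> ?S" for n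
  proof -
    let ?M = "density lborel (indicator (cball 0 (real n) :: real set))"
    have em: "emeasure ?M B = emeasure lborel (B \<inter> cball 0 (real n))" if "B \<in> sets borel" for B
      using that by (subst emeasure_density)
        (auto simp: indicator_inter_arith[symmetric] Int_commute intro!: borel_measurable_indicator)
    have "emeasure ?M (space ?M) \<noteq> \<infinity>"
      using em[of UNIV] emeasure_lborel_cball_finite[of "0::real" "real n"] by (simp add: less_top)
    then have "emeasure ?M A = (SUP K\<in>{K. K \<subseteq> A \<and> compact K}. emeasure ?M K)"
      by (intro inner_regular) auto
    also have "\<dots> \<le> ?S"
    proof (rule SUP_mono)
      fix K assume K: "K \<in> {K. K \<subseteq> A \<and> compact K}"
      then have "emeasure ?M K \<le> emeasure lborel K"
        by (subst em) (auto intro!: emeasure_mono borel_compact)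
      with K show "\<exists>m\<in>{K. K \<subseteq> A \<and> compact K}. emeasure ?M K \<le> emeasure lborel m" by blast
    qed
    finally show ?thesis using em[of A] by simp
  qed
  have "emeasure lborel A = emeasure lborel (\<Union>n. A \<inter> cball 0 (real n))"
    by (rule arg_cong[where f="emeasure lborel"]) (auto simp: real_arch_simple)
  also have "\<dots> = (SUP n. emeasure lborel (A \<inter> cball 0 (real n)))"
    by (rule SUP_emeasure_incseq[symmetric]) (auto simp: incseq_def)
  also have "\<dots> \<le> ?S" by (intro SUP_least bounded_part)
  finally show "emeasure lborel A \<le> ?S" .
  show "?S \<le> emeasure lborel A" by (intro SUP_least) (auto intro: emeasure_mono)
qed

lemma emeasure_lborel_midpoint_vimage:
  fixes C :: "real set"
  assumes [measurable]: "C \<in> sets borel"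
  shows "emeasure lborel {x. (x + m) / 2 \<in> C} = 2 * emeasure lborel C"
proof -
  have [measurable]: "{x. (x + m) / 2 \<in> C} \<in> sets borel"
  proof -
    have "(\<lambda>x. (x + m) / 2) -` C \<inter> space borel \<in> sets borel"
      by (rule measurable_sets[of _ borel borel]) auto
    then show ?thesis by (simp add: vimage_def)
  qed
  have "emeasure lborel C = (\<integral>\<^sup>+x. indicator C x \<partial>lborel)" by simp
  also have "\<dots> = ennreal \<bar>1/2\<bar> * (\<integral>\<^sup>+x. indicator C (m / 2 + (1/2) * x) \<partial>lborel)"
    by (rule nn_integral_real_affine) auto
  also have "(\<integral>\<^sup>+x. indicator C (m / 2 + (1/2) * x) \<partial>lborel)
      = (\<integral>\<^sup>+x. indicator {x. (x + m) / 2 \<in> C} x \<partial>lborel)"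
    by (intro nn_integral_cong) (auto simp: indicator_def field_simps)
  also have "\<dots> = emeasure lborel {x. (x + m) / 2 \<in> C}" by simp
  finally have "2 * emeasure lborel C = (2 * ennreal (1/2)) * emeasure lborel {x. (x + m) / 2 \<in> C}"
    by (simp add: mult.assoc)
  also have "2 * ennreal (1/2) = 1"
    by (metis ennreal_1 ennreal_mult ennreal_numeral le_numeral_extra(1) mult_2 field_sum_of_halves zero_le_divide_1_iff zero_le_numeral)
  finally show ?thesis by simp
qed

text \<open>Let \<open>M = max K\<close> and \<open>m = min L\<close>. The half-size copies \<open>(K + m) / 2\<close> and \<open>(M + L) / 2\<close> both lie in
\<open>C\<close>, on different sides of the point \<open>(M + m) / 2\<close>, so their lengths add up.\<close>

lemma brunn_minkowski_compact_real:
  fixes K L C :: "real set"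
  assumes K: "compact K" "K \<noteq> {}" and L: "compact L" "L \<noteq> {}"
    and [measurable]: "C \<in> sets borel"
    and mid: "\<And>x y. x \<in> K \<Longrightarrow> y \<in> L \<Longrightarrow> (x + y) / 2 \<in> C"
  shows "emeasure lborel K + emeasure lborel L \<le> 2 * emeasure lborel C"
proof -
  obtain M where M: "M \<in> K" "\<And>x. x \<in> K \<Longrightarrow> x \<le> M" using compact_attains_sup[OF K] by blast
  obtain m where m: "m \<in> L" "\<And>x. x \<in> L \<Longrightarrow> m \<le> x" using compact_attains_inf[OF L] by blast
  define c where "c = (M + m) / 2"
  have "emeasure lborel K \<le> emeasure lborel {x. (x + m) / 2 \<in> C \<inter> {..c}}"
  proof (rule emeasure_mono)
    show "K \<subseteq> {x. (x + m) / 2 \<in> C \<inter> {..c}}" using M m mid by (auto simp: c_def)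
    have "(\<lambda>x. (x + m) / 2) -` (C \<inter> {..c}) \<inter> space borel \<in> sets borel"
      by (rule measurable_sets[of _ borel borel]) auto
    then show "{x. (x + m) / 2 \<in> C \<inter> {..c}} \<in> sets lborel" by (simp add: vimage_def)
  qed
  also have "\<dots> = 2 * emeasure lborel (C \<inter> {..c})" by (rule emeasure_lborel_midpoint_vimage) auto
  finally have 1: "emeasure lborel K \<le> 2 * emeasure lborel (C \<inter> {..c})" .
  have "emeasure lborel L \<le> emeasure lborel {x. (x + M) / 2 \<in> C \<inter> {c..}}"
  proof (rule emeasure_mono)
    show "L \<subseteq> {x. (x + M) / 2 \<in> C \<inter> {c..}}"
      using M m mid[of M] by (auto simp: c_def add.commute)
    have "(\<lambda>x. (x + M) / 2) -` (C \<inter> {c..}) \<inter> space borel \<in> sets borel"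
      by (rule measurable_sets[of _ borel borel]) auto
    then show "{x. (x + M) / 2 \<in> C \<inter> {c..}} \<in> sets lborel" by (simp add: vimage_def)
  qed
  also have "\<dots> = 2 * emeasure lborel (C \<inter> {c..})" by (rule emeasure_lborel_midpoint_vimage) auto
  also have "emeasure lborel (C \<inter> {c..}) \<le> emeasure lborel (C \<inter> {c<..} \<union> {c})"
    by (rule emeasure_mono) auto
  also have "\<dots> \<le> emeasure lborel (C \<inter> {c<..}) + emeasure lborel {c}"
    by (rule emeasure_subadditive) auto
  also have "\<dots> = emeasure lborel (C \<inter> {c<..})" by simp
  finally have 2: "emeasure lborel L \<le> 2 * emeasure lborel (C \<inter> {c<..})"
    by (metis (no_types, lifting) mult_left_mono order_trans zero_le)
  have "emeasure lborel C = emeasure lborel ((C \<inter> {..c}) \<union> (C \<inter> {c<..}))"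
    by (rule arg_cong[where f="emeasure lborel"]) auto
  also have "\<dots> = emeasure lborel (C \<inter> {..c}) + emeasure lborel (C \<inter> {c<..})"
    by (rule plus_emeasure[symmetric]) auto
  finally show ?thesis using add_mono[OF 1 2] by (simp add: distrib_left)
qed

lemma brunn_minkowski_real:
  fixes A B C :: "real set"
  assumes [measurable]: "A \<in> sets borel" "B \<in> sets borel" "C \<in> sets borel"
    and ne: "A \<noteq> {}" "B \<noteq> {}"
    and mid: "\<And>x y. x \<in> A \<Longrightarrow> y \<in> B \<Longrightarrow> (x + y) / 2 \<in> C"
  shows "emeasure lborel A + emeasure lborel B \<le> 2 * emeasure lborel C"
proof -
  have compacts: "emeasure lborel K + emeasure lborel L \<le> 2 * emeasure lborel C"
    if K: "K \<subseteq> A \<and> compact K" and L: "L \<subseteq> B \<and> compact L" for K L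
  proof -
    obtain a b where ab: "a \<in> A" "b \<in> B" using ne by blast
    \<comment> \<open>The compact case needs nonempty sets, so a point of \<open>A\<close>, resp. \<open>B\<close>, is thrown in.\<close>
    have "emeasure lborel K + emeasure lborel L
        \<le> emeasure lborel (insert a K) + emeasure lborel (insert b L)"
      using K L by (intro add_mono emeasure_mono) (auto intro!: borel_compact)
    also have "\<dots> \<le> 2 * emeasure lborel C"
      using K L ab mid by (intro brunn_minkowski_compact_real) auto
    finally show ?thesis .
  qed
  have 1: "emeasure lborel A + emeasure lborel L \<le> 2 * emeasure lborel C"
    if "L \<subseteq> B \<and> compact L" for L
  proof -
    have "emeasure lborel A + emeasure lborel L
        = (SUP K\<in>{K. K \<subseteq> A \<and> compact K}. emeasure lborel K + emeasure lborel L)"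
      by (subst emeasure_lborel_SUP_compact[of A]) (auto intro!: ennreal_SUP_add_left[symmetric])
    also have "\<dots> \<le> 2 * emeasure lborel C" using compacts that by (intro SUP_least) auto
    finally show ?thesis .
  qed
  have "emeasure lborel A + emeasure lborel B
      = (SUP L\<in>{K. K \<subseteq> B \<and> compact K}. emeasure lborel A + emeasure lborel L)"
    unfolding add.commute[of "emeasure lborel A"]
    by (subst emeasure_lborel_SUP_compact[of B]) (auto intro!: ennreal_SUP_add_left[symmetric])
  also have "\<dots> \<le> 2 * emeasure lborel C" using 1 by (intro SUP_least) auto
  finally show ?thesis .
qed

text \<open>The layers are cut off at height 1, the common supremum of the functions \<open>u\<close> and \<open>v\<close> in the
next lemma; for \<open>w\<close> the truncation can only lose mass.\<close>

lemma nn_integral_layer_cake: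
  fixes u :: "real \<Rightarrow> ennreal"
  assumes [measurable]: "u \<in> borel_measurable borel"
  shows "(\<integral>\<^sup>+s. indicator {0<..<1} s * emeasure lborel {x. ennreal s < u x} \<partial>lborel)
      = (\<integral>\<^sup>+x. min 1 (u x) \<partial>lborel)"
proof -
  have slice: "(\<integral>\<^sup>+s. indicator {0<..<1} s * indicator {x. ennreal s < u x} x \<partial>lborel) = min 1 (u x)" for x
  proof (cases "u x \<le> 1")
    case True
    then obtain r where r: "u x = ennreal r" "0 \<le> r" "r \<le> 1"
      by (metis ennreal_cases ennreal_le_1 neq_top_trans ennreal_one_neq_top)
    have "(\<integral>\<^sup>+s. indicator {0<..<1} s * indicator {x. ennreal s < u x} x \<partial>lborel)
        = (\<integral>\<^sup>+s. indicator {0<..<r} s \<partial>lborel)"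
      using r by (intro nn_integral_cong) (auto simp: indicator_def ennreal_less_iff)
    then show ?thesis using r True by (simp add: min_def)
  next
    case False
    have "(\<integral>\<^sup>+s. indicator {0<..<1} s * indicator {x. ennreal s < u x} x \<partial>lborel)
        = (\<integral>\<^sup>+s. indicator {0<..<1::real} s \<partial>lborel)"
    proof (intro nn_integral_cong)
      fix s :: real
      have "ennreal s < u x" if "0 < s" "s < 1"
      proof -
        have "ennreal s < 1" using that by (simp add: ennreal_less_one_iff)
        also have "1 < u x" using False by simp
        finally show ?thesis .
      qed
      then show "indicator {0<..<1} s * indicator {x. ennreal s < u x} x
          = (indicator {0<..<1} s :: ennreal)" by (auto simp: indicator_def)
    qed
    then show ?thesis using False by (simp add: min_def)
  qed
  have "(\<integral>\<^sup>+s. indicator {0<..<1} s * emeasure lborel {x. ennreal s < u x} \<partial>lborel)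
     = (\<integral>\<^sup>+s. \<integral>\<^sup>+x. indicator {0<..<1} s * indicator {x. ennreal s < u x} x \<partial>lborel \<partial>lborel)"
    by (simp add: nn_integral_cmult)
  also have "\<dots> = (\<integral>\<^sup>+x. \<integral>\<^sup>+s. indicator {0<..<1} s * indicator {x. ennreal s < u x} x \<partial>lborel \<partial>lborel)"
    by (rule lborel_pair.Fubini') (simp add: indicator_def case_prod_beta)
  finally show ?thesis by (simp add: slice)
qed

text \<open>Since \<open>u\<close> and \<open>v\<close> have the same supremum, their superlevel sets at any height \<open>s < 1\<close> are both
nonempty; midpoints of points in them satisfy \<open>w\<^sup>2 > s\<^sup>2\<close>. So Brunn-Minkowski compares the three
superlevel sets at height \<open>s\<close>, and integration over \<open>s\<close> gives even the arithmetic mean on the left.\<close>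

lemma prekopa_leindler_real_normalized:
  fixes u v w :: "real \<Rightarrow> ennreal"
  assumes [measurable]: "u \<in> borel_measurable borel" "v \<in> borel_measurable borel" "w \<in> borel_measurable borel"
    and mid: "\<And>x y. u x * v y \<le> (w ((x + y) / 2))\<^sup>2"
    and u: "(SUP x. u x) = 1" and v: "(SUP x. v x) = 1"
  shows "(\<integral>\<^sup>+x. u x \<partial>lborel) + (\<integral>\<^sup>+x. v x \<partial>lborel) \<le> 2 * (\<integral>\<^sup>+x. w x \<partial>lborel)"
proof -
  let ?m = "\<lambda>u s. emeasure lborel {x. ennreal s < u x}"
  have level: "?m u s + ?m v s \<le> 2 * ?m w s" if s: "0 < s" "s < 1" for s
  proof (rule brunn_minkowski_real)
    have "ennreal s < 1" using s by (simp add: ennreal_less_one_iff)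
    then show "{x. ennreal s < u x} \<noteq> {}" "{x. ennreal s < v x} \<noteq> {}"
      using u v less_SUP_iff[of "ennreal s" u UNIV] less_SUP_iff[of "ennreal s" v UNIV] by auto
    fix x y assume "x \<in> {x. ennreal s < u x}" "y \<in> {x. ennreal s < v x}"
    then have x: "ennreal s < u x" and y: "ennreal s < v y" by auto
    have "ennreal s * ennreal s < ennreal s * v y"
      using s y by (intro ennreal_mult_strict_left_mono) auto
    also have "\<dots> \<le> u x * v y" using x by (intro mult_right_mono) auto
    also have "\<dots> \<le> (w ((x + y) / 2))\<^sup>2" by (rule mid)
    finally show "(x + y) / 2 \<in> {x. ennreal s < w x}"
      by (simp add: power2_eq_square) (meson mult_mono not_le zero_le)
  qed auto
  have min1: "min 1 (u x) = u x" "min 1 (v x) = v x" for x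
    using u v SUP_upper[of x UNIV u] SUP_upper[of x UNIV v] by (auto simp: min_def)
  have "(\<integral>\<^sup>+x. u x \<partial>lborel) + (\<integral>\<^sup>+x. v x \<partial>lborel)
      = (\<integral>\<^sup>+s. indicator {0<..<1} s * ?m u s \<partial>lborel) + (\<integral>\<^sup>+s. indicator {0<..<1} s * ?m v s \<partial>lborel)"
    by (simp add: nn_integral_layer_cake min1)
  also have "\<dots> = (\<integral>\<^sup>+s. indicator {0<..<1} s * ?m u s + indicator {0<..<1} s * ?m v s \<partial>lborel)"
    by (rule nn_integral_add[symmetric]) auto
  also have "\<dots> \<le> (\<integral>\<^sup>+s. 2 * (indicator {0<..<1} s * ?m w s) \<partial>lborel)"
    using level by (intro nn_integral_mono) (auto simp: indicator_def)
  also have "\<dots> = 2 * (\<integral>\<^sup>+x. min 1 (w x) \<partial>lborel)"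
    by (subst nn_integral_cmult) (auto simp: nn_integral_layer_cake)
  also have "\<dots> \<le> 2 * (\<integral>\<^sup>+x. w x \<partial>lborel)"
    by (intro mult_left_mono nn_integral_mono) auto
  finally show ?thesis .
qed

lemma ennreal_mult_le_square:
  fixes a b c :: ennreal
  assumes "a + b \<le> 2 * c"
  shows "a * b \<le> c\<^sup>2"
proof (cases "c = \<infinity>")
  case True
  then show ?thesis by (simp add: power2_eq_square)
next
  case False
  then have "2 * c < \<infinity>" by (simp add: ennreal_mult_less_top less_top)
  then have ab: "a + b < \<infinity>" using assms by (rule le_less_trans[rotated])
  then obtain x y z where r: "a = ennreal x" "b = ennreal y" "c = ennreal z" "0 \<le> x" "0 \<le> y" "0 \<le> z"
    using False by (metis ennreal_add_eq_top ennreal_cases infinity_ennreal_def less_irrefl)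
  have "ennreal (x + y) \<le> ennreal (2 * z)"
    using assms r by (simp add: ennreal_mult ennreal_plus)
  then have "x + y \<le> 2 * z" using r by (subst (asm) ennreal_le_iff) auto
  then have "(x + y)\<^sup>2 \<le> (2 * z)\<^sup>2" using r by (intro power_mono) auto
  moreover have "0 \<le> (x - y)\<^sup>2" by simp
  ultimately have "x * y \<le> z\<^sup>2" by (simp add: power2_eq_square algebra_simps)
  then show ?thesis using r by (simp add: ennreal_mult[symmetric] ennreal_power ennreal_leI)
qed

text \<open>Dividing \<open>u\<close>, \<open>v\<close>, \<open>w\<close> by \<open>A = sup u\<close>, \<open>B = sup v\<close> and \<open>sqrt (A * B)\<close> keeps the hypothesis and
normalizes the suprema. The arithmetic-geometric mean inequality then turns the sum into a product,
in which the normalizing factors cancel.\<close>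

lemma prekopa_leindler_real_bounded:
  fixes u v w :: "real \<Rightarrow> ennreal"
  assumes [measurable]: "u \<in> borel_measurable borel" "v \<in> borel_measurable borel" "w \<in> borel_measurable borel"
    and mid: "\<And>x y. u x * v y \<le> (w ((x + y) / 2))\<^sup>2"
    and fin: "(SUP x. u x) < \<infinity>" "(SUP x. v x) < \<infinity>"
  shows "(\<integral>\<^sup>+x. u x \<partial>lborel) * (\<integral>\<^sup>+x. v x \<partial>lborel) \<le> (\<integral>\<^sup>+x. w x \<partial>lborel)\<^sup>2"
proof (cases "(SUP x. u x) = 0 \<or> (SUP x. v x) = 0")
  case True
  then have "(\<forall>x. u x = 0) \<or> (\<forall>x. v x = 0)"
    by (metis UNIV_I SUP_upper le_zero_eq)
  then show ?thesis by auto
next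
  case False
  obtain A B where AB: "(SUP x. u x) = ennreal A" "(SUP x. v x) = ennreal B" "0 < A" "0 < B"
    using fin False by (metis ennreal_cases ennreal_0 less_irrefl infinity_ennreal_def order_le_less)
  define r where "r = sqrt (A * B)"
  have r: "r > 0" "r\<^sup>2 = A * B" using AB by (auto simp: r_def)
  define U where "U x = ennreal (1/A) * u x" for x
  define V where "V x = ennreal (1/B) * v x" for x
  define W where "W x = ennreal (1/r) * w x" for x
  have [measurable]: "U \<in> borel_measurable borel" "V \<in> borel_measurable borel" "W \<in> borel_measurable borel"
    unfolding U_def V_def W_def by auto
  have cmult: "(\<integral>\<^sup>+x. c * f x \<partial>lborel) = c * (\<integral>\<^sup>+x. f x \<partial>lborel)"
    if "f \<in> borel_measurable borel" for c and f :: "real \<Rightarrow> ennreal"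
    using that by (intro nn_integral_cmult) auto
  have scal: "ennreal (1/A) * ennreal (1/B) = (ennreal (1/r))\<^sup>2"
    using AB r by (simp add: ennreal_mult[symmetric] ennreal_power power_divide)
  have "(SUP x. U x) = 1" "(SUP x. V x) = 1"
    unfolding U_def V_def using AB
    by (simp_all add: SUP_mult_left_ennreal[symmetric] ennreal_mult[symmetric])
  moreover have "U x * V y \<le> (W ((x + y) / 2))\<^sup>2" for x y
  proof -
    have "U x * V y = (ennreal (1/r))\<^sup>2 * (u x * v y)"
      unfolding scal[symmetric] U_def V_def by (simp add: mult_ac)
    also have "\<dots> \<le> (ennreal (1/r))\<^sup>2 * (w ((x + y) / 2))\<^sup>2"
      by (intro mult_left_mono mid) auto
    finally show ?thesis by (simp add: W_def power_mult_distrib)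
  qed
  ultimately have "(\<integral>\<^sup>+x. U x \<partial>lborel) + (\<integral>\<^sup>+x. V x \<partial>lborel) \<le> 2 * (\<integral>\<^sup>+x. W x \<partial>lborel)"
    by (intro prekopa_leindler_real_normalized) auto
  then have "(\<integral>\<^sup>+x. U x \<partial>lborel) * (\<integral>\<^sup>+x. V x \<partial>lborel) \<le> (\<integral>\<^sup>+x. W x \<partial>lborel)\<^sup>2"
    by (rule ennreal_mult_le_square)
  then have "(ennreal (1/A) * (\<integral>\<^sup>+x. u x \<partial>lborel)) * (ennreal (1/B) * (\<integral>\<^sup>+x. v x \<partial>lborel))
      \<le> (ennreal (1/r) * (\<integral>\<^sup>+x. w x \<partial>lborel))\<^sup>2"
    unfolding U_def V_def W_def cmult[OF assms(1)] cmult[OF assms(2)] cmult[OF assms(3)] .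
  then have "(ennreal (1/r))\<^sup>2 * ((\<integral>\<^sup>+x. u x \<partial>lborel) * (\<integral>\<^sup>+x. v x \<partial>lborel))
      \<le> (ennreal (1/r))\<^sup>2 * (\<integral>\<^sup>+x. w x \<partial>lborel)\<^sup>2"
    unfolding power_mult_distrib scal[symmetric] by (simp only: mult_ac)
  then have "(ennreal r)\<^sup>2 * ((ennreal (1/r))\<^sup>2 * ((\<integral>\<^sup>+x. u x \<partial>lborel) * (\<integral>\<^sup>+x. v x \<partial>lborel)))
      \<le> (ennreal r)\<^sup>2 * ((ennreal (1/r))\<^sup>2 * (\<integral>\<^sup>+x. w x \<partial>lborel)\<^sup>2)"
    by (rule mult_left_mono) simp
  moreover have "(ennreal r)\<^sup>2 * (ennreal (1/r))\<^sup>2 = 1"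
    using r by (simp add: power_mult_distrib[symmetric] ennreal_mult[symmetric])
  ultimately show ?thesis by (simp only: mult.assoc[symmetric] mult_1_left)
qed

text \<open>Replacing \<open>u\<close> and \<open>v\<close> by their truncations at height \<open>n\<close> preserves the hypothesis, and monotone
convergence recovers \<open>u\<close> and \<open>v\<close>.\<close>

lemma prekopa_leindler_real:
  fixes u v w :: "real \<Rightarrow> ennreal"
  assumes [measurable]: "u \<in> borel_measurable borel" "v \<in> borel_measurable borel" "w \<in> borel_measurable borel"
    and mid: "\<And>x y. u x * v y \<le> (w ((x + y) / 2))\<^sup>2"
  shows "(\<integral>\<^sup>+x. u x \<partial>lborel) * (\<integral>\<^sup>+x. v x \<partial>lborel) \<le> (\<integral>\<^sup>+x. w x \<partial>lborel)\<^sup>2"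
proof -
  let ?t = "\<lambda>u n x. min (u x) (of_nat n :: ennreal)"
  have lim: "(\<integral>\<^sup>+x. u x \<partial>lborel) = (SUP n. \<integral>\<^sup>+x. ?t u n x \<partial>lborel)"
    if [measurable]: "u \<in> borel_measurable borel" for u :: "real \<Rightarrow> ennreal"
  proof -
    have "(SUP n. ?t u n x) = u x" for x
    proof -
      have "(SUP n. min (u x) (of_nat n :: ennreal)) = min (u x) (SUP n. of_nat n)"
        by (simp add: inf_min[symmetric] inf_SUP)
      then show ?thesis by (simp add: ennreal_SUP_of_nat_eq_top)
    qed
    then have "(\<integral>\<^sup>+x. u x \<partial>lborel) = (\<integral>\<^sup>+x. (SUP n. ?t u n x) \<partial>lborel)" by simp
    also have "\<dots> = (SUP n. \<integral>\<^sup>+x. ?t u n x \<partial>lborel)"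
      by (rule nn_integral_monotone_convergence_SUP)
        (auto simp: incseq_def le_fun_def intro!: min.mono simp del: min.bounded_iff)
    finally show ?thesis .
  qed
  have bdd: "(SUP x. ?t u n x) < \<infinity>" for u :: "real \<Rightarrow> ennreal" and n
    by (rule le_less_trans[of _ "of_nat n"]) (auto intro!: SUP_least simp: of_nat_less_top)
  have trunc: "(\<integral>\<^sup>+x. ?t u n x \<partial>lborel) * (\<integral>\<^sup>+x. ?t v k x \<partial>lborel) \<le> (\<integral>\<^sup>+x. w x \<partial>lborel)\<^sup>2" for n k
    using bdd by (intro prekopa_leindler_real_bounded)
      (auto intro!: order_trans[OF mult_mono mid])
  have "(\<integral>\<^sup>+x. u x \<partial>lborel) * (\<integral>\<^sup>+x. ?t v k x \<partial>lborel) \<le> (\<integral>\<^sup>+x. w x \<partial>lborel)\<^sup>2" for k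
    unfolding lim[of u, simplified] SUP_mult_right_ennreal by (intro SUP_least trunc)
  then show ?thesis
    unfolding lim[of v, simplified] SUP_mult_left_ennreal by (intro SUP_least)
qed

text \<open>Integrating out one coordinate preserves the hypothesis: for fixed remaining coordinates this is
the one-dimensional inequality. Hence the induction on the set of coordinates. The functions are
merely measurable with values in \<^typ>\<open>ennreal\<close> because marginals are not known to be better.\<close>

lemma prekopa_leindler_PiM:
  fixes u v w :: "('i \<Rightarrow> real) \<Rightarrow> ennreal"
  assumes "finite I"
    and "u \<in> borel_measurable (PiM I (\<lambda>_. lborel))" "v \<in> borel_measurable (PiM I (\<lambda>_. lborel))"
      "w \<in> borel_measurable (PiM I (\<lambda>_. lborel))"
    and "\<And>x y. x \<in> PiE I (\<lambda>_. UNIV) \<Longrightarrow> y \<in> PiE I (\<lambda>_. UNIV) \<Longrightarrow>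
      u x * v y \<le> (w (\<lambda>i\<in>I. (x i + y i) / 2))\<^sup>2"
  shows "(\<integral>\<^sup>+x. u x \<partial>PiM I (\<lambda>_. lborel)) * (\<integral>\<^sup>+x. v x \<partial>PiM I (\<lambda>_. lborel))
      \<le> (\<integral>\<^sup>+x. w x \<partial>PiM I (\<lambda>_. lborel))\<^sup>2"
  using assms
proof (induction I arbitrary: u v w rule: finite_induct)
  case empty
  then show ?case by (simp add: nn_integral_empty restrict_def PiM_empty nn_integral_count_space_finite)
next
  case (insert i I)
  interpret product_sigma_finite "\<lambda>_::'i. lborel :: real measure" ..
  note [measurable] = insert.prems(1-3)
  have fib[measurable]: "(\<lambda>(x, t). f (x(i := t))) \<in> borel_measurable (PiM I (\<lambda>_. lborel) \<Otimes>\<^sub>M lborel)"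
    if [measurable]: "f \<in> borel_measurable (PiM (insert i I) (\<lambda>_. lborel))" for f :: "('i \<Rightarrow> real) \<Rightarrow> ennreal"
    by measurable
  have fib1: "(\<lambda>t. f (x(i := t))) \<in> borel_measurable borel"
    if "f \<in> borel_measurable (PiM (insert i I) (\<lambda>_. lborel))" "x \<in> PiE I (\<lambda>_. UNIV)" for f :: "('i \<Rightarrow> real) \<Rightarrow> ennreal" and x
    using measurable_compose[OF measurable_Pair1' fib[OF that(1)], of x] that(2) by (simp add: space_PiM)
  have marg: "(\<lambda>x. \<integral>\<^sup>+t. f (x(i := t)) \<partial>lborel) \<in> borel_measurable (PiM I (\<lambda>_. lborel))"
    if "f \<in> borel_measurable (PiM (insert i I) (\<lambda>_. lborel))" for f :: "('i \<Rightarrow> real) \<Rightarrow> ennreal"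
    using lborel.borel_measurable_nn_integral[OF fib[OF that]] by simp
  show ?case
    unfolding product_nn_integral_insert[OF insert.hyps insert.prems(1)]
      product_nn_integral_insert[OF insert.hyps insert.prems(2)]
      product_nn_integral_insert[OF insert.hyps insert.prems(3)]
  proof (rule insert.IH)
    fix x y :: "'i \<Rightarrow> real" assume xy: "x \<in> PiE I (\<lambda>_. UNIV)" "y \<in> PiE I (\<lambda>_. UNIV)"
    have z: "(\<lambda>j\<in>I. (x j + y j) / 2) \<in> PiE I (\<lambda>_. UNIV)" by auto
    show "(\<integral>\<^sup>+t. u (x(i := t)) \<partial>lborel) * (\<integral>\<^sup>+t. v (y(i := t)) \<partial>lborel)
        \<le> (\<integral>\<^sup>+t. w ((\<lambda>j\<in>I. (x j + y j) / 2)(i := t)) \<partial>lborel)\<^sup>2"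
    proof (rule prekopa_leindler_real)
      fix s t
      have "u (x(i := s)) * v (y(i := t))
          \<le> (w (\<lambda>j\<in>insert i I. ((x(i := s)) j + (y(i := t)) j) / 2))\<^sup>2"
        using xy by (intro insert.prems(4)) (auto simp: PiE_def extensional_def)
      also have "(\<lambda>j\<in>insert i I. ((x(i := s)) j + (y(i := t)) j) / 2)
          = (\<lambda>j\<in>I. (x j + y j) / 2)(i := (s + t) / 2)"
        using insert.hyps by (auto simp: fun_eq_iff)
      finally show "u (x(i := s)) * v (y(i := t))
          \<le> (w ((\<lambda>j\<in>I. (x j + y j) / 2)(i := (s + t) / 2)))\<^sup>2" .
    qed (use fib1 insert.prems xy z in auto)
  qed (rule marg[OF insert.prems(1)] marg[OF insert.prems(2)] marg[OF insert.prems(3)])+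
qed

theorem prekopa_leindler_midpoint:
  fixes u v w :: "'a::euclidean_space \<Rightarrow> ennreal"
  assumes [measurable]: "u \<in> borel_measurable borel" "v \<in> borel_measurable borel" "w \<in> borel_measurable borel"
    and mid: "\<And>x y. u x * v y \<le> (w ((1/2) *\<^sub>R (x + y)))\<^sup>2"
  shows "(\<integral>\<^sup>+x. u x \<partial>lborel) * (\<integral>\<^sup>+x. v x \<partial>lborel) \<le> (\<integral>\<^sup>+x. w x \<partial>lborel)\<^sup>2"
proof -
  let ?P = "PiM (Basis :: 'a set) (\<lambda>_. lborel :: real measure)"
  let ?T = "\<lambda>f. \<Sum>b\<in>Basis. f b *\<^sub>R b :: 'a"
  have T[measurable]: "?T \<in> measurable ?P borel" by measurable
  have transfer: "(\<integral>\<^sup>+x. f x \<partial>lborel) = (\<integral>\<^sup>+x. f (?T x) \<partial>?P)"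
    if [measurable]: "f \<in> borel_measurable borel" for f :: "'a \<Rightarrow> ennreal"
    by (subst lborel_eq) (simp add: nn_integral_distr)
  show ?thesis
    unfolding transfer[OF assms(1)] transfer[OF assms(2)] transfer[OF assms(3)]
  proof (rule prekopa_leindler_PiM)
    fix x y :: "'a \<Rightarrow> real"
    have "?T (\<lambda>i\<in>Basis. (x i + y i) / 2) = (1/2) *\<^sub>R (?T x + ?T y)"
      by (simp add: scaleR_sum_right sum.distrib[symmetric] scaleR_add_left[symmetric] add_divide_distrib)
    then show "u (?T x) * v (?T y) \<le> (w (?T (\<lambda>i\<in>Basis. (x i + y i) / 2)))\<^sup>2"
      using mid[of "?T x" "?T y"] by simp
  qed auto
qed

section \<open>Densities that increase along a direction\<close>

text \<open>The half-spaces \<open>A m = {y. m (u \<bullet> u) \<le> u \<bullet> y}\<close> are translates of each other by multiples of \<open>u\<close>,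
so their masses do not decrease with \<open>m\<close>. The half-spaces themselves shrink to the empty set; for
finite total mass all these masses are therefore zero, and for \<open>m \<rightarrow> -\<infinity>\<close> they exhaust the space.\<close>

lemma nn_integral_nondecreasing_along:
  fixes \<psi> :: "'a::euclidean_space \<Rightarrow> ennreal"
  assumes [measurable]: "\<psi> \<in> borel_measurable borel"
    and u: "u \<noteq> 0" and mono: "\<And>y. \<psi> y \<le> \<psi> (u + y)"
  shows "(\<integral>\<^sup>+y. \<psi> y \<partial>lborel) = 0 \<or> (\<integral>\<^sup>+y. \<psi> y \<partial>lborel) = \<infinity>"
proof (rule disjCI)
  assume fin: "(\<integral>\<^sup>+y. \<psi> y \<partial>lborel) \<noteq> \<infinity>"
  define M where "M = density lborel \<psi>"
  define A where "A m = {y. real_of_int m * (u \<bullet> u) \<le> u \<bullet> y}" for m :: int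
  have q: "u \<bullet> u > 0" using u by simp
  have Am[measurable]: "A m \<in> sets borel" for m unfolding A_def by measurable
  have sM: "sets M = sets borel" by (simp add: M_def)
  have anti: "A m \<subseteq> A k" if "k \<le> m" for k m
  proof -
    have "real_of_int k * (u \<bullet> u) \<le> real_of_int m * (u \<bullet> u)"
      using that q by (intro mult_right_mono) auto
    then show ?thesis by (auto simp: A_def)
  qed
  have em: "emeasure M (A m) = (\<integral>\<^sup>+y. \<psi> y * indicator (A m) y \<partial>lborel)" for m
    unfolding M_def by (subst emeasure_density) auto
  have UM: "emeasure M UNIV = (\<integral>\<^sup>+y. \<psi> y \<partial>lborel)"
    unfolding M_def by (subst emeasure_density) auto
  have step: "emeasure M (A m) \<le> emeasure M (A (m + 1))" for m
  proof -
    have "emeasure M (A (m + 1)) = (\<integral>\<^sup>+y. \<psi> y * indicator (A (m + 1)) y \<partial>distr lborel borel ((+) u))"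
      by (simp add: em lborel_distr_plus)
    also have "\<dots> = (\<integral>\<^sup>+y. \<psi> (u + y) * indicator (A (m + 1)) (u + y) \<partial>lborel)"
      by (subst nn_integral_distr) auto
    also have "\<dots> \<ge> emeasure M (A m)"
      unfolding em
      by (intro nn_integral_mono mult_mono mono)
        (auto simp: A_def indicator_def inner_add_right algebra_simps)
    finally show ?thesis .
  qed
  have up: "emeasure M (A 0) \<le> emeasure M (A (int n))" for n
  proof (induction n)
    case (Suc n)
    then show ?case using step[of "int n"] by (simp add: add.commute)
  qed simp
  have down: "emeasure M (A (- int n)) \<le> emeasure M (A 0)" for n
  proof (induction n)
    case (Suc n)
    then show ?case using step[of "- int (Suc n)"] by simp
  qed simp
  have "(INF n. emeasure M (A (int n))) = emeasure M (\<Inter>n. A (int n))"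
  proof (rule INF_emeasure_decseq)
    show "range (\<lambda>n. A (int n)) \<subseteq> sets M" by (auto simp: sM)
    show "decseq (\<lambda>n. A (int n))"
      using anti by (auto simp: decseq_def)
    show "emeasure M (A (int n)) \<noteq> \<infinity>" for n
      using fin emeasure_mono[of "A (int n)" UNIV M] by (auto simp: sM UM top_unique)
  qed
  also have "(\<Inter>n. A (int n)) = {}"
  proof -
    have "\<exists>n. \<not> real n * (u \<bullet> u) \<le> u \<bullet> y" for y
      using q reals_Archimedean3[of "u \<bullet> u"] by (metis not_le)
    then show ?thesis by (auto simp: A_def)
  qed
  finally have "(INF n. emeasure M (A (int n))) = 0" by simp
  moreover have "emeasure M (A 0) \<le> (INF n. emeasure M (A (int n)))"
    by (intro INF_greatest up)
  ultimately have A0: "emeasure M (A 0) = 0" by simp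
  have "(\<Union>n. A (- int n)) = UNIV"
  proof -
    have "\<exists>n. real_of_int (- int n) * (u \<bullet> u) \<le> u \<bullet> y" for y
    proof -
      obtain n where "- (u \<bullet> y) < real n * (u \<bullet> u)"
        using q reals_Archimedean3[of "u \<bullet> u"] by blast
      then show ?thesis by (intro exI[of _ n]) simp
    qed
    then show ?thesis by (auto simp: A_def)
  qed
  then have "emeasure M UNIV = (SUP n. emeasure M (A (- int n)))"
    using anti by (subst SUP_emeasure_incseq) (auto simp: sM incseq_def)
  also have "\<dots> \<le> 0" using down A0 by (intro SUP_least) auto
  finally show "(\<integral>\<^sup>+y. \<psi> y \<partial>lborel) = 0" by (simp add: UM)
qed

section \<open>Legendre transforms\<close>

lemma fenchel_young: "ereal (x \<bullet> y) - f x \<le> legendre f y"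
  unfolding legendre_def by (rule SUP_upper) simp

lemma open_superlevel_legendre: "open {y. a < legendre f y}"
proof -
  have "open {y. a < ereal (x \<bullet> y) - f x}" for x
  proof (cases "f x")
    case (real r)
    have "continuous_on UNIV (\<lambda>y. ereal (x \<bullet> y - r))" by (intro continuous_intros)
    then have "open {y. a < ereal (x \<bullet> y - r)}" by (intro open_Collect_less) auto
    then show ?thesis using real by simp
  qed auto
  moreover have "{y. a < legendre f y} = (\<Union>x. {y. a < ereal (x \<bullet> y) - f x})"
    by (auto simp: legendre_def less_SUP_iff)
  ultimately show ?thesis by auto
qed

text \<open>The filter \<^term>\<open>at x\<close> leaves out \<open>x\<close>, but the inequality \<open>a < f x\<close> is given there.\<close>

lemma lower_semicontinuous_iff_open_superlevel:
  fixes f :: "'a::topological_space \<Rightarrow> ereal"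
  shows "(\<forall>x. f x \<le> Liminf (at x) f) \<longleftrightarrow> (\<forall>a. open {x. a < f x})"
proof
  assume *: "\<forall>x. f x \<le> Liminf (at x) f"
  show "\<forall>a. open {x. a < f x}"
  proof
    fix a
    have "\<exists>T. open T \<and> x \<in> T \<and> T \<subseteq> {x. a < f x}" if "a < f x" for x
    proof -
      have "eventually (\<lambda>z. a < f z) (at x)" using * that by (auto simp: le_Liminf_iff)
      then obtain T where "open T" "x \<in> T" "\<forall>z\<in>T. z \<noteq> x \<longrightarrow> a < f z"
        by (auto simp: eventually_at_topological)
      then show ?thesis using that by (intro exI[of _ T]) auto
    qed
    then show "open {x. a < f x}" by (subst open_subopen) auto
  qed
next
  assume *: "\<forall>a. open {x. a < f x}"
  show "\<forall>x. f x \<le> Liminf (at x) f"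
    unfolding le_Liminf_iff
  proof (intro allI impI)
    fix x a assume "a < f x"
    with * show "\<forall>\<^sub>F z in at x. a < f z"
      unfolding eventually_at_topological by (intro exI[of _ "{x. a < f x}"]) auto
  qed
qed

lemma borel_measurable_open_superlevel:
  fixes f :: "'a::topological_space \<Rightarrow> ereal"
  assumes "\<And>a. open {x. a < f x}"
  shows "f \<in> borel_measurable borel"
  using assms by (intro borel_measurableI_greater) auto

lemma borel_measurable_legendre [measurable]: "legendre f \<in> borel_measurable borel"
  by (intro borel_measurable_open_superlevel open_superlevel_legendre)

lemma lsc_convex_measurable: "f \<in> lsc_convex \<Longrightarrow> f \<in> borel_measurable borel"
  unfolding lsc_convex_def using lower_semicontinuous_iff_open_superlevel[of f]
  by (intro borel_measurable_open_superlevel) auto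

lemma convex_domain:
  assumes "f \<in> lsc_convex"
  shows "convex {x. f x \<noteq> \<infinity>}"
proof (rule convexI)
  fix x y and u v :: real
  assume *: "x \<in> {x. f x \<noteq> \<infinity>}" "y \<in> {x. f x \<noteq> \<infinity>}" "0 \<le> u" "0 \<le> v" "u + v = 1"
  have "f (u *\<^sub>R x + v *\<^sub>R y) \<le> ereal u * f x + ereal v * f y"
    using assms * by (auto simp: lsc_convex_def)
  also have "\<dots> < \<infinity>"
    using * assms by (cases "f x"; cases "f y") (auto simp: lsc_convex_def)
  finally show "u *\<^sub>R x + v *\<^sub>R y \<in> {x. f x \<noteq> \<infinity>}" by auto
qed

lemma legendre_not_MInf: "f x \<noteq> \<infinity> \<Longrightarrow> legendre f y \<noteq> -\<infinity>"
  using fenchel_young[of x y f] by (cases "f x") auto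

lemma convex_legendre:
  assumes "u \<ge> 0" "v \<ge> 0" "u + v = 1"
  shows "legendre f (u *\<^sub>R x + v *\<^sub>R y) \<le> ereal u * legendre f x + ereal v * legendre f y"
  unfolding legendre_def[of f "u *\<^sub>R x + v *\<^sub>R y"]
proof (rule SUP_least)
  fix z
  consider "f z = \<infinity>" | "f z = -\<infinity>" | r where "f z = ereal r" by (cases "f z") auto
  then show "ereal (z \<bullet> (u *\<^sub>R x + v *\<^sub>R y)) - f z \<le> ereal u * legendre f x + ereal v * legendre f y"
  proof cases
    case 1
    then show ?thesis by simp
  next
    case 2
    then have "legendre f w = \<infinity>" for w using fenchel_young[of z w f] by simp
    then have "legendre f x = \<infinity>" "legendre f y = \<infinity>" by auto
    moreover have "u > 0 \<or> v > 0" using assms by linarith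
    ultimately have eq: "ereal u * legendre f x + ereal v * legendre f y = \<infinity>"
      using assms(1,2) by auto
    show ?thesis unfolding eq by simp
  next
    case 3
    have "ereal (z \<bullet> (u *\<^sub>R x + v *\<^sub>R y)) - f z
        = ereal (u * (z \<bullet> x - r) + v * (z \<bullet> y - r))"
    proof -
      have "z \<bullet> (u *\<^sub>R x + v *\<^sub>R y) - (u + v) * r = u * (z \<bullet> x - r) + v * (z \<bullet> y - r)"
        by (simp add: inner_add_right algebra_simps)
      then show ?thesis using 3 assms by simp
    qed
    also have "\<dots> = ereal u * (ereal (z \<bullet> x) - f z) + ereal v * (ereal (z \<bullet> y) - f z)"
      using 3 by simp
    also have "\<dots> \<le> ereal u * legendre f x + ereal v * legendre f y"
      using assms by (intro add_mono ereal_mult_left_mono fenchel_young) auto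
    finally show ?thesis .
  qed
qed

text \<open>Whatever \<open>f\<close> is, its transform is a supremum of affine functions, so only properness has to be
assumed. This is how functions constructed below are recognized as elements of
\<^term>\<open>lsc_convex\<close>.\<close>

lemma legendre_in_lsc_convex:
  assumes "f x \<noteq> \<infinity>" "legendre f y \<noteq> \<infinity>"
  shows "legendre f \<in> lsc_convex"
  unfolding lsc_convex_def
proof (intro CollectI conjI)
  show "\<forall>x. legendre f x \<noteq> -\<infinity>" using legendre_not_MInf assms by blast
  show "\<forall>x. legendre f x \<le> Liminf (at x) (legendre f)"
    using lower_semicontinuous_iff_open_superlevel[of "legendre f"] open_superlevel_legendre by blast
qed (use assms convex_legendre in blast)+

lemma legendre_legendre_le: "legendre (legendre f) x \<le> f x"
  unfolding legendre_def[of "legendre f"]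
proof (rule SUP_least)
  fix y show "ereal (y \<bullet> x) - legendre f y \<le> f x"
    using fenchel_young[of x y f]
    by (cases "f x"; cases "legendre f y") (auto simp: inner_commute)
qed

text \<open>A point \<open>(x0, r0)\<close> below the graph is separated from the epigraph, which is closed and convex, by a
half-space \<open>{(x, r). u \<bullet> x + s * r > b}\<close> containing the epigraph. For \<open>s > 0\<close> its boundary is the
graph of an affine minorant of \<open>f\<close> that exceeds \<open>r0\<close> at \<open>x0\<close>. For \<open>s = 0\<close> the boundary is vertical;
then \<open>b - u \<bullet> x\<close> is positive at \<open>x0\<close> and negative on the domain of \<open>f\<close>, so adding a large multiple
of it to the affine minorant of slope \<open>y0\<close> gives a minorant exceeding \<open>r0\<close> at \<open>x0\<close>.\<close>

theorem fenchel_moreau: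
  fixes f :: "real^'n \<Rightarrow> ereal"
  assumes f: "f \<in> lsc_convex" and y0: "legendre f y0 \<noteq> \<infinity>"
  shows "legendre (legendre f) = f"
proof
  fix x0
  have notM: "f x \<noteq> -\<infinity>" for x using f by (auto simp: lsc_convex_def)
  obtain x1 where x1: "f x1 \<noteq> \<infinity>" using f by (auto simp: lsc_convex_def)
  obtain r1 where r1: "f x1 = ereal r1" using x1 notM[of x1] by (cases "f x1") auto
  obtain \<beta> where \<beta>: "legendre f y0 = ereal \<beta>"
    using y0 legendre_not_MInf[of f x1, OF x1] by (cases "legendre f y0") auto
  have op: "open {x. a < f x}" for a
    using f lower_semicontinuous_iff_open_superlevel[of f] by (auto simp: lsc_convex_def)
  have cvx: "f (u *\<^sub>R x + v *\<^sub>R y) \<le> ereal u * f x + ereal v * f y"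
    if "u \<ge> 0" "v \<ge> 0" "u + v = 1" for u v x y
    using f that by (auto simp: lsc_convex_def)
  define epi where "epi = {p. f (fst p) \<le> ereal (snd p)}"
  have "convex epi"
  proof (rule convexI)
    fix p q and u v :: real assume *: "p \<in> epi" "q \<in> epi" "0 \<le> u" "0 \<le> v" "u + v = 1"
    have "f (u *\<^sub>R fst p + v *\<^sub>R fst q) \<le> ereal u * f (fst p) + ereal v * f (fst q)"
      using * by (intro cvx) auto
    also have "\<dots> \<le> ereal u * ereal (snd p) + ereal v * ereal (snd q)"
      using * by (intro add_mono ereal_mult_left_mono) (auto simp: epi_def)
    finally show "u *\<^sub>R p + v *\<^sub>R q \<in> epi" by (simp add: epi_def)
  qed
  moreover have "closed epi"
  proof -
    have "- epi = (\<Union>q::real. {x. ereal q < f x} \<times> {..<q})"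
    proof (intro set_eqI iffI)
      fix p assume "p \<in> - epi"
      then have "ereal (snd p) < f (fst p)" by (auto simp: epi_def)
      then obtain q where "ereal (snd p) < ereal q" "ereal q < f (fst p)"
        using ereal_dense2 by blast
      then show "p \<in> (\<Union>q::real. {x. ereal q < f x} \<times> {..<q})" by (cases p) auto
    next
      fix p assume "p \<in> (\<Union>q::real. {x. ereal q < f x} \<times> {..<q})"
      then obtain q where "ereal q < f (fst p)" "snd p < q" by (cases p) auto
      then have "ereal (snd p) < f (fst p)" by (meson ereal_less_le less_imp_le order_le_less_trans ereal_less_eq(3))
      then show "p \<in> - epi" by (auto simp: epi_def)
    qed
    then have "open (- epi)" by (auto intro!: open_UN open_Times op)
    then show ?thesis by (simp add: closed_def)
  qed
  ultimately have sep: "\<exists>a b. a \<bullet> z < b \<and> (\<forall>p\<in>epi. b < a \<bullet> p)" if "z \<notin> epi" for z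
    using separating_hyperplane_closed_point[of epi z] that by auto
  have below: "ereal r0 \<le> legendre (legendre f) x0" if r0: "ereal r0 < f x0" for r0
  proof -
    have "(x0, r0) \<notin> epi" using r0 by (auto simp: epi_def)
    then obtain a b where ab: "a \<bullet> (x0, r0) < b" "\<forall>p\<in>epi. b < a \<bullet> p" using sep by blast
    obtain u s where us: "a = (u, s)" by (cases a)
    have z: "u \<bullet> x0 + s * r0 < b" using ab(1) us by simp
    have e: "b < u \<bullet> x + s * r" if "f x \<le> ereal r" for x r
      using ab(2) that us by (auto simp: epi_def)
    have "s \<ge> 0"
    proof (rule ccontr)
      assume "\<not> s \<ge> 0"
      then have s: "s < 0" by simp
      \<comment> \<open>The epigraph contains a vertical ray, on which \<open>u \<bullet> x1 + s * r\<close> would be unbounded below.\<close>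
      define r where "r = max r1 ((b - u \<bullet> x1) / s)"
      have "f x1 \<le> ereal r" by (simp add: r1 r_def)
      then have "b < u \<bullet> x1 + s * r" by (rule e)
      moreover have "s * r \<le> s * ((b - u \<bullet> x1) / s)" using s by (intro mult_left_mono_neg) (auto simp: r_def)
      ultimately show False using s by simp
    qed
    then consider "s > 0" | "s = 0" by linarith
    then show ?thesis
    proof cases
      case 1
      \<comment> \<open>slope of the boundary hyperplane, solved for \<open>r\<close>\<close>
      define y where "y = (- 1 / s) *\<^sub>R u"
      have "legendre f y \<le> ereal (- b / s)"
        unfolding legendre_def
      proof (rule SUP_least)
        fix x
        show "ereal (x \<bullet> y) - f x \<le> ereal (- b / s)"
        proof (cases "f x")
          case (real r)
          then have "b < u \<bullet> x + s * r" by (intro e) simp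
          then have "(b - u \<bullet> x) / s < r" using 1 by (simp add: pos_divide_less_eq mult.commute)
          then have "x \<bullet> y - r \<le> - b / s"
            by (simp add: y_def inner_commute diff_divide_distrib)
          then show ?thesis using real by simp
        qed (use notM in auto)
      qed
      then have "ereal (y \<bullet> x0) - ereal (- b / s) \<le> ereal (y \<bullet> x0) - legendre f y"
        by (intro ereal_minus_mono) auto
      also have "\<dots> \<le> legendre (legendre f) x0" by (rule fenchel_young)
      finally have "ereal (y \<bullet> x0 + b / s) \<le> legendre (legendre f) x0" by simp
      moreover have "r0 \<le> y \<bullet> x0 + b / s"
        using z 1 by (simp add: y_def field_simps)
      ultimately show ?thesis by (meson ereal_less_eq(3) order_trans)
    next
      case 2
      have z': "b - u \<bullet> x0 > 0" using z 2 by simp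
      obtain k :: nat where k: "r0 - (y0 \<bullet> x0 - \<beta>) < real k * (b - u \<bullet> x0)"
        using reals_Archimedean3[OF z'] by blast
      define y where "y = y0 - real k *\<^sub>R u"
      have "legendre f y \<le> ereal (\<beta> - real k * b)"
        unfolding legendre_def
      proof (rule SUP_least)
        fix x
        show "ereal (x \<bullet> y) - f x \<le> ereal (\<beta> - real k * b)"
        proof (cases "f x")
          case (real r)
          then have "b < u \<bullet> x" using e[of x r] 2 by simp
          then have "real k * b \<le> real k * (u \<bullet> x)" by (intro mult_left_mono) auto
          moreover have "x \<bullet> y0 - r \<le> \<beta>"
            using fenchel_young[of x y0 f] real \<beta> by simp
          ultimately have "x \<bullet> y - r \<le> \<beta> - real k * b"
            by (simp add: y_def inner_diff_right inner_commute)
          then show ?thesis using real by simp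
        qed (use notM in auto)
      qed
      then have "ereal (y \<bullet> x0) - ereal (\<beta> - real k * b) \<le> ereal (y \<bullet> x0) - legendre f y"
        by (intro ereal_minus_mono) auto
      also have "\<dots> \<le> legendre (legendre f) x0" by (rule fenchel_young)
      finally have "ereal (y \<bullet> x0 - (\<beta> - real k * b)) \<le> legendre (legendre f) x0" by simp
      moreover have "r0 \<le> y \<bullet> x0 - (\<beta> - real k * b)"
        using k by (simp add: y_def inner_diff_left algebra_simps)
      ultimately show ?thesis by (meson ereal_less_eq(3) order_trans)
    qed
  qed
  have "f x0 \<le> legendre (legendre f) x0"
  proof (rule ccontr)
    assume "\<not> ?thesis"
    then have "legendre (legendre f) x0 < f x0" by simp
    then obtain r where "legendre (legendre f) x0 < ereal r" "ereal r < f x0"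
      using ereal_dense2 by blast
    with below[of r] show False by auto
  qed
  with legendre_legendre_le[of f x0] show "legendre (legendre f) x0 = f x0" by (rule antisym)
qed

section \<open>Exponential masses, logarithms and integrals of extended real functions\<close>

lemma exp_ereal_simps [simp]:
  "exp_ereal (ereal r) = ennreal (exp r)" "exp_ereal \<infinity> = \<infinity>" "exp_ereal (-\<infinity>) = 0"
  by (auto simp: exp_ereal_def)

lemma exp_ereal_mono: "x \<le> y \<Longrightarrow> exp_ereal x \<le> exp_ereal y"
  by (cases x; cases y) (auto intro: ennreal_leI)

lemma exp_ereal_eq_0_iff: "exp_ereal x = 0 \<longleftrightarrow> x = -\<infinity>"
  by (cases x) auto

lemma borel_measurable_exp_ereal [measurable]: "exp_ereal \<in> borel_measurable borel"
  unfolding exp_ereal_def[abs_def] by measurable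

lemma exp_mass_antimono: "(\<And>x. f x \<le> g x) \<Longrightarrow> exp_mass g \<le> exp_mass f"
  unfolding exp_mass_def by (intro nn_integral_mono exp_ereal_mono) (simp add: ereal_minus_le_minus)

lemma log_ennreal_mono: "a \<le> b \<Longrightarrow> log_ennreal a \<le> log_ennreal b"
  by (cases a; cases b) (auto simp: log_ennreal_def top_unique ennreal_eq_0_iff)

lemma ereal_L1_integrable:
  assumes "f \<in> ereal_L1 \<nu>"
  shows "AE x in \<nu>. f x \<noteq> \<infinity> \<and> f x \<noteq> -\<infinity>"
    and "integrable \<nu> (\<lambda>x. real_of_ereal (f x))"
    and "ereal_integral \<nu> f = ereal (\<integral>x. real_of_ereal (f x) \<partial>\<nu>)"
    and "ereal_integral \<nu> (\<lambda>x. - f x) = ereal (- (\<integral>x. real_of_ereal (f x) \<partial>\<nu>))"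
proof -
  have m[measurable]: "f \<in> borel_measurable \<nu>" and fin: "(\<integral>\<^sup>+x. e2ennreal \<bar>f x\<bar> \<partial>\<nu>) < \<infinity>"
    using assms by (auto simp: ereal_L1_def)
  have "AE x in \<nu>. e2ennreal \<bar>f x\<bar> \<noteq> \<infinity>"
    using fin by (intro nn_integral_PInf_AE) auto
  then show ae: "AE x in \<nu>. f x \<noteq> \<infinity> \<and> f x \<noteq> -\<infinity>"
    by eventually_elim auto
  let ?g = "\<lambda>x. real_of_ereal (f x)"
  have aeg: "AE x in \<nu>. e2ennreal \<bar>f x\<bar> = ennreal \<bar>?g x\<bar>"
    "AE x in \<nu>. e2ennreal (f x) = ennreal (?g x)" "AE x in \<nu>. e2ennreal (- f x) = ennreal (- ?g x)"
    using ae by (eventually_elim, case_tac "f x", auto)+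
  show int: "integrable \<nu> ?g"
    using fin nn_integral_cong_AE[OF aeg(1)] by (intro integrableI_bounded) auto
  have ex: "ereal (\<integral>x. h x \<partial>\<nu>) = enn2ereal (\<integral>\<^sup>+x. ennreal (h x) \<partial>\<nu>) - enn2ereal (\<integral>\<^sup>+x. ennreal (- h x) \<partial>\<nu>)"
    if h: "integrable \<nu> h" for h :: "_ \<Rightarrow> real"
  proof -
    obtain r q where "0 \<le> r" "(\<integral>\<^sup>+x. ennreal (h x) \<partial>\<nu>) = ennreal r"
      "0 \<le> q" "(\<integral>\<^sup>+x. ennreal (- h x) \<partial>\<nu>) = ennreal q" "(\<integral>x. h x \<partial>\<nu>) = r - q"
      using integrableE[OF h] by metis
    then show ?thesis by (simp add: enn2ereal_ennreal)
  qed
  show "ereal_integral \<nu> f = ereal (\<integral>x. ?g x \<partial>\<nu>)"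
    unfolding ereal_integral_def ex[OF int] nn_integral_cong_AE[OF aeg(2)] nn_integral_cong_AE[OF aeg(3)] ..
  have "integrable \<nu> (\<lambda>x. - ?g x)" using int by simp
  from ex[OF this] show "ereal_integral \<nu> (\<lambda>x. - f x) = ereal (- (\<integral>x. ?g x \<partial>\<nu>))"
    unfolding ereal_integral_def ereal_uminus_uminus minus_minus
      nn_integral_cong_AE[OF aeg(2)] nn_integral_cong_AE[OF aeg(3)] by simp
qed

lemma ereal_L1_sandwich:
  assumes [measurable]: "g \<in> borel_measurable \<nu>" and l: "integrable \<nu> l" and u: "integrable \<nu> u"
    and ae: "AE x in \<nu>. ereal (l x) \<le> g x \<and> g x \<le> ereal (u x)"
  shows "g \<in> ereal_L1 \<nu>" and "ereal_integral \<nu> (\<lambda>x. - g x) \<ge> ereal (- (\<integral>x. u x \<partial>\<nu>))"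
proof -
  have "(\<integral>\<^sup>+x. e2ennreal \<bar>g x\<bar> \<partial>\<nu>) \<le> (\<integral>\<^sup>+x. ennreal (\<bar>l x\<bar> + \<bar>u x\<bar>) \<partial>\<nu>)"
  proof (rule nn_integral_mono_AE)
    show "AE x in \<nu>. e2ennreal \<bar>g x\<bar> \<le> ennreal (\<bar>l x\<bar> + \<bar>u x\<bar>)"
      using ae
    proof eventually_elim
      case (elim x)
      then show ?case by (cases "g x") (auto intro!: ennreal_leI simp del: ennreal_plus)
    qed
  qed
  also have "\<dots> < \<infinity>"
  proof -
    have "integrable \<nu> (\<lambda>x. \<bar>l x\<bar> + \<bar>u x\<bar>)" using l u by auto
    then show ?thesis by (simp add: integrable_iff_bounded)
  qed
  finally show L1: "g \<in> ereal_L1 \<nu>" by (simp add: ereal_L1_def)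
  have "(\<integral>x. real_of_ereal (g x) \<partial>\<nu>) \<le> (\<integral>x. u x \<partial>\<nu>)"
  proof (rule integral_mono_AE)
    show "AE x in \<nu>. real_of_ereal (g x) \<le> u x"
      using ae
    proof eventually_elim
      case (elim x)
      then show ?case by (cases "g x") auto
    qed
  qed (use u ereal_L1_integrable[OF L1] in auto)
  then show "ereal_integral \<nu> (\<lambda>x. - g x) \<ge> ereal (- (\<integral>x. u x \<partial>\<nu>))"
    unfolding ereal_L1_integrable(4)[OF L1] by simp
qed

text \<open>An integrable minorant makes the negative part integrable; then no indeterminate difference occurs
in \<^term>\<open>ereal_integral \<nu> g\<close>, and its finiteness bounds the positive part.\<close>

lemma ereal_L1_minorant:
  assumes [measurable]: "g \<in> borel_measurable \<nu>" and l: "integrable \<nu> l"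
    and le: "\<And>x. ereal (l x) \<le> g x" and fin: "ereal_integral \<nu> g < \<infinity>"
  shows "g \<in> ereal_L1 \<nu>"
proof -
  have "(\<integral>\<^sup>+x. e2ennreal (- g x) \<partial>\<nu>) \<le> (\<integral>\<^sup>+x. ennreal (norm (l x)) \<partial>\<nu>)"
  proof (rule nn_integral_mono)
    fix x
    show "e2ennreal (- g x) \<le> ennreal (norm (l x))"
      using le[of x] by (cases "g x") (auto intro!: ennreal_leI simp: e2ennreal_neg)
  qed
  also have "\<dots> < \<infinity>" using l by (simp add: integrable_iff_bounded)
  finally have neg: "(\<integral>\<^sup>+x. e2ennreal (- g x) \<partial>\<nu>) < \<infinity>" .
  then have pos: "(\<integral>\<^sup>+x. e2ennreal (g x) \<partial>\<nu>) < \<infinity>"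
    using fin unfolding ereal_integral_def
    by (cases "\<integral>\<^sup>+x. e2ennreal (g x) \<partial>\<nu>"; cases "\<integral>\<^sup>+x. e2ennreal (- g x) \<partial>\<nu>") (auto simp: enn2ereal_ennreal)
  have "(\<integral>\<^sup>+x. e2ennreal \<bar>g x\<bar> \<partial>\<nu>) \<le> (\<integral>\<^sup>+x. e2ennreal (g x) + e2ennreal (- g x) \<partial>\<nu>)"
    by (intro nn_integral_mono, case_tac "g x") (auto simp: abs_if)
  also have "\<dots> = (\<integral>\<^sup>+x. e2ennreal (g x) \<partial>\<nu>) + (\<integral>\<^sup>+x. e2ennreal (- g x) \<partial>\<nu>)"
    by (rule nn_integral_add) auto
  also have "\<dots> < \<infinity>" using pos neg by simp
  finally show ?thesis by (simp add: ereal_L1_def)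
qed

lemma prob1D:
  assumes "\<nu> \<in> prob1"
  shows "sets \<nu> = sets borel" "space \<nu> = UNIV" "prob_space \<nu>"
    "integrable \<nu> (\<lambda>x. norm x)" "integrable \<nu> (\<lambda>x. x \<bullet> y + r)"
    "f \<in> borel_measurable borel \<Longrightarrow> f \<in> borel_measurable \<nu>"
proof -
  show s: "sets \<nu> = sets borel" and p: "prob_space \<nu>" and n: "integrable \<nu> (\<lambda>x. norm x)"
    using assms by (auto simp: prob1_def borel_prob_def)
  show "space \<nu> = UNIV" using sets_eq_imp_space_eq[OF s] by simp
  interpret prob_space \<nu> by (rule p)
  note [measurable_cong] = s
  have "integrable \<nu> (\<lambda>x. norm x * norm y)" using n by simp
  then have "integrable \<nu> (\<lambda>x. x \<bullet> y)"
    by (rule Bochner_Integration.integrable_bound) (auto simp: Cauchy_Schwarz_ineq2)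
  then show "integrable \<nu> (\<lambda>x. x \<bullet> y + r)" by simp
  show "f \<in> borel_measurable borel \<Longrightarrow> f \<in> borel_measurable \<nu>" by measurable
qed

section \<open>Measures carried by a hyperplane\<close>

lemma K_Leb_ge:
  assumes "f \<in> ereal_L1 \<nu>" "f \<in> lsc_convex"
  shows "ereal_integral \<nu> (\<lambda>x. - f x) + log_ennreal (exp_mass (legendre f)) \<le> K_Leb \<nu>"
  unfolding K_Leb_def using assms by (intro SUP_upper) auto

text \<open>The test function is the norm on the hyperplane and \<open>\<infinity>\<close> off it, which is \<open>\<nu>\<close>-integrable. Its
transform is affine of slope \<open>b\<close> in the direction of the normal \<open>a\<close>, so it does not increase in one
of the directions \<open>a\<close>, \<open>-a\<close>, and its exponential mass is infinite.\<close>

lemma K_Leb_hyperplane: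
  fixes \<nu> :: "(real^'n) measure"
  assumes \<nu>: "\<nu> \<in> prob1" and a: "a \<noteq> 0" and hyp: "AE x in \<nu>. a \<bullet> x = b"
  shows "K_Leb \<nu> = \<infinity>"
proof -
  define h where "h x = (if a \<bullet> x = b then ereal (norm x) else \<infinity>)" for x
  have hMInf: "h x \<noteq> -\<infinity>" for x by (simp add: h_def)
  define x0 where "x0 = (b / (a \<bullet> a)) *\<^sub>R a"
  have x0: "a \<bullet> x0 = b" using a by (simp add: x0_def)
  have op: "open {x. s < h x}" for s
  proof -
    have "{x. s < h x} = {x. a \<bullet> x \<noteq> b \<and> s \<noteq> \<infinity>} \<union> {x. s < ereal (norm x)}"
      by (auto simp: h_def)
    moreover have "open {x. a \<bullet> x \<noteq> b}" by (intro open_Collect_neq continuous_intros)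
    moreover have "open {x :: real^'n. s < ereal (norm x)}"
      by (intro open_Collect_less continuous_intros)
    ultimately show ?thesis by (cases "s = \<infinity>") auto
  qed
  have lsc: "h \<in> lsc_convex"
    unfolding lsc_convex_def
  proof (intro CollectI conjI allI impI)
    show "h x \<noteq> -\<infinity>" for x by (rule hMInf)
    show "\<exists>x. h x \<noteq> \<infinity>" using x0 by (intro exI[of _ x0]) (simp add: h_def)
    show "h x \<le> Liminf (at x) h" for x
      using lower_semicontinuous_iff_open_superlevel[of h] op by blast
    fix x y :: "real^'n" and u v :: real assume uv: "u \<ge> 0 \<and> v \<ge> 0 \<and> u + v = 1"
    consider "u = 0" "v = 1" | "v = 0" "u = 1" | "u > 0" "v > 0" using uv by linarith
    then show "h (u *\<^sub>R x + v *\<^sub>R y) \<le> ereal u * h x + ereal v * h y"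
    proof cases
      case 3
      show ?thesis
      proof (cases "a \<bullet> x = b \<and> a \<bullet> y = b")
        case True
        have "u * b + v * b = b" using uv by (metis distrib_right mult_1)
        then have "a \<bullet> (u *\<^sub>R x + v *\<^sub>R y) = b" using True by (simp add: inner_add_right)
        moreover have "norm (u *\<^sub>R x + v *\<^sub>R y) \<le> u * norm x + v * norm y"
          using uv norm_triangle_ineq[of "u *\<^sub>R x" "v *\<^sub>R y"] by simp
        ultimately show ?thesis using True by (simp add: h_def)
      next
        case False
        then have "ereal u * h x + ereal v * h y = \<infinity>" using 3 by (auto simp: h_def)
        then show ?thesis by (metis ereal_less_eq(1))
      qed
    qed (auto simp: zero_ereal_def[symmetric])
  qed
  have "AE x in \<nu>. ereal (norm x) \<le> h x \<and> h x \<le> ereal (norm x)"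
    using hyp by eventually_elim (simp add: h_def)
  then have L1: "h \<in> ereal_L1 \<nu>"
    using prob1D[OF \<nu>] lsc_convex_measurable[OF lsc] by (intro ereal_L1_sandwich) auto
  \<comment> \<open>orientation of the normal for which \<open>\<sigma> * b \<le> 0\<close>\<close>
  define \<sigma> where "\<sigma> = (if b > 0 then -1 else 1 :: real)"
  have "legendre h (\<sigma> *\<^sub>R a + y) \<le> legendre h y" for y
    unfolding legendre_def
  proof (rule SUP_mono')
    fix x
    show "ereal (x \<bullet> (\<sigma> *\<^sub>R a + y)) - h x \<le> ereal (x \<bullet> y) - h x"
      by (auto simp: h_def \<sigma>_def inner_add_right inner_commute[of x a])
  qed
  then have "(\<integral>\<^sup>+y. exp_ereal (- legendre h y) \<partial>lborel) = 0 \<or>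
      (\<integral>\<^sup>+y. exp_ereal (- legendre h y) \<partial>lborel) = \<infinity>"
    using a by (intro nn_integral_nondecreasing_along[of _ "\<sigma> *\<^sub>R a"])
      (auto intro!: exp_ereal_mono simp: \<sigma>_def ereal_minus_le_minus)
  moreover have "(\<integral>\<^sup>+y. exp_ereal (- legendre h y) \<partial>lborel) \<noteq> 0"
  proof -
    \<comment> \<open>On the unit ball \<open>x \<bullet> y \<le> norm x\<close>, so the transform is nonpositive there.\<close>
    have le: "exp_ereal (- legendre h y) \<ge> indicator (ball 0 1) y" for y
    proof (cases "norm y < 1")
      case True
      have "legendre h y \<le> 0"
        unfolding legendre_def
      proof (rule SUP_least)
        fix x
        have "x \<bullet> y \<le> norm x * norm y" by (rule norm_cauchy_schwarz)
        also have "\<dots> \<le> norm x * 1" using True by (intro mult_left_mono) auto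
        finally show "ereal (x \<bullet> y) - h x \<le> 0" by (simp add: h_def)
      qed
      then have "exp_ereal 0 \<le> exp_ereal (- legendre h y)"
        by (intro exp_ereal_mono) simp
      then show ?thesis using True exp_ereal_simps(1)[of 0] by (simp add: zero_ereal_def)
    qed auto
    have "(\<integral>\<^sup>+y. indicator (ball (0::real^'n) 1) y \<partial>lborel) \<le> (\<integral>\<^sup>+y. exp_ereal (- legendre h y) \<partial>lborel)"
      by (rule nn_integral_mono) (rule le)
    moreover have "(\<integral>\<^sup>+y. indicator (ball (0::real^'n) 1) y \<partial>lborel) \<noteq> 0"
    proof -
      have "\<not> negligible (ball (0::real^'n) 1)" by (rule open_not_negligible) auto
      then have "ball (0::real^'n) 1 \<notin> null_sets lborel"
        unfolding negligible_iff_null_sets using null_sets_completionI by blast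
      then show ?thesis by (auto simp: null_sets_def)
    qed
    ultimately show ?thesis by auto
  qed
  ultimately have "log_ennreal (exp_mass (legendre h)) = \<infinity>"
    by (simp add: exp_mass_def log_ennreal_def)
  then show ?thesis using K_Leb_ge[OF L1 lsc] ereal_L1_integrable(4)[OF L1] by simp
qed

text \<open>The domain of \<open>g\<close> carries \<open>\<nu>\<close> and is a Lebesgue null set. Being convex, it lies in a hyperplane.\<close>

lemma K_Leb_infinite_if_exp_mass_0:
  fixes \<nu> :: "(real^'n) measure"
  assumes \<nu>: "\<nu> \<in> prob1" and g: "g \<in> lsc_convex" and 0: "exp_mass g = 0"
    and fin: "AE x in \<nu>. g x \<noteq> \<infinity>"
  shows "K_Leb \<nu> = \<infinity>"
proof -
  have [measurable]: "g \<in> borel_measurable borel" by (rule lsc_convex_measurable[OF g])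
  define D where "D = {x. g x \<noteq> \<infinity>}"
  have [measurable]: "D \<in> sets borel" unfolding D_def by measurable
  have "convex D" unfolding D_def by (rule convex_domain[OF g])
  moreover have "negligible D"
  proof -
    have "AE x in lborel. exp_ereal (- g x) = 0"
      using 0 by (subst (asm) exp_mass_def, subst (asm) nn_integral_0_iff_AE) auto
    then have "AE x in lborel. x \<notin> D"
      by eventually_elim (simp add: exp_ereal_eq_0_iff D_def ereal_uminus_eq_reorder)
    then have "D \<in> null_sets lborel" by (subst (asm) AE_iff_null_sets[symmetric]) auto
    then show ?thesis by (simp add: negligible_iff_null_sets null_sets_completionI)
  qed
  ultimately have "interior D = {}" using negligible_convex_interior by blast
  with \<open>convex D\<close> obtain a b where ab: "a \<noteq> 0" "D \<subseteq> {x. a \<bullet> x = b}"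
    by (rule empty_interior_subset_hyperplane)
  have "AE x in \<nu>. a \<bullet> x = b" using fin by eventually_elim (use ab D_def in auto)
  then show ?thesis using K_Leb_hyperplane[OF \<nu> ab(1)] by blast
qed

section \<open>Groups of sign changes\<close>

text \<open>All functions, symmetric functions and unconditional functions are the functions invariant under
the group consisting of the constant sign \<open>1\<close>, of the constant signs \<open>\<plusminus>1\<close>, and of all sign vectors,
respectively; likewise for measures. Arguing with an arbitrary group of sign vectors covers the three
cases at once. Every sign vector is its own inverse, so closure under products makes \<open>E\<close> a group.\<close>

definition sign_group :: "('n::finite \<Rightarrow> real) set \<Rightarrow> bool" where
  "sign_group E \<longleftrightarrow> E \<subseteq> UNIV \<rightarrow> {-1, 1} \<and> (\<lambda>_. 1) \<in> E \<and>
     (\<forall>\<epsilon>\<in>E. \<forall>\<delta>\<in>E. (\<lambda>i. \<epsilon> i * \<delta> i) \<in> E)"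

definition lsc_convex_inv :: "('n::finite \<Rightarrow> real) set \<Rightarrow> (real^'n \<Rightarrow> ereal) set" where
  "lsc_convex_inv E = {f \<in> lsc_convex. \<forall>\<epsilon>\<in>E. \<forall>x. f (sign_change \<epsilon> x) = f x}"

definition prob1_inv :: "('n::finite \<Rightarrow> real) set \<Rightarrow> (real^'n) measure set" where
  "prob1_inv E = {\<nu> \<in> prob1. \<forall>\<epsilon>\<in>E. distr \<nu> borel (sign_change \<epsilon>) = \<nu>}"

lemma sign_group_signs: "sign_group E \<Longrightarrow> \<epsilon> \<in> E \<Longrightarrow> \<epsilon> \<in> UNIV \<rightarrow> {-1, 1}"
  by (auto simp: sign_group_def)

lemma sign_group_finite:
  fixes E :: "('n::finite \<Rightarrow> real) set"
  assumes "sign_group E"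
  shows "finite E" "E \<noteq> {}"
proof -
  have "finite ((UNIV :: 'n set) \<rightarrow>\<^sub>E {-1, 1 :: real})" by (intro finite_PiE) auto
  moreover have "E \<subseteq> (UNIV :: 'n set) \<rightarrow>\<^sub>E {-1, 1}"
    using assms unfolding sign_group_def PiE_UNIV_domain by (auto simp: Pi_def)
  ultimately show "finite E" by (rule finite_subset[rotated])
  show "E \<noteq> {}" using assms by (auto simp: sign_group_def)
qed

lemma sign_square: "\<epsilon> \<in> UNIV \<rightarrow> {-1, 1 :: real} \<Longrightarrow> \<epsilon> i * \<epsilon> i = 1"
  using Pi_mem[of \<epsilon> UNIV "\<lambda>_. {-1, 1}" i] by auto

lemma sign_change_sign_change: "sign_change \<epsilon> (sign_change \<delta> x) = sign_change (\<lambda>i. \<epsilon> i * \<delta> i) x"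
  by (simp add: sign_change_def vec_eq_iff mult.assoc)

lemma sign_change_involution:
  assumes "\<epsilon> \<in> UNIV \<rightarrow> {-1, 1}"
  shows "sign_change \<epsilon> (sign_change \<epsilon> x) = x"
proof -
  have "\<epsilon> i * \<epsilon> i = 1" for i using assms by (rule sign_square)
  then show ?thesis by (simp add: sign_change_sign_change) (simp add: sign_change_def vec_eq_iff)
qed

lemma inner_sign_change: "sign_change \<epsilon> x \<bullet> y = x \<bullet> sign_change \<epsilon> y"
  by (simp add: inner_vec_def sign_change_def mult_ac)

lemma inner_sign_change_both:
  "\<epsilon> \<in> UNIV \<rightarrow> {-1, 1} \<Longrightarrow> sign_change \<epsilon> x \<bullet> sign_change \<epsilon> y = x \<bullet> y"
  by (simp add: inner_sign_change sign_change_involution)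

lemma borel_measurable_sign_change [measurable]: "sign_change \<epsilon> \<in> borel_measurable borel"
  unfolding sign_change_def[abs_def]
  by (intro borel_measurable_continuous_onI continuous_intros)

lemma sum_sign_group_shift:
  fixes E :: "('n::finite \<Rightarrow> real) set"
  assumes E: "sign_group E" and \<delta>: "\<delta> \<in> E"
  shows "(\<Sum>\<epsilon>\<in>E. F (sign_change \<epsilon> (sign_change \<delta> x))) = (\<Sum>\<epsilon>\<in>E. F (sign_change \<epsilon> x))"
proof -
  have sq: "\<delta> i * \<delta> i = 1" for i using sign_group_signs[OF E \<delta>] by (rule sign_square)
  show ?thesis
    by (rule sum.reindex_bij_witness[where i="\<lambda>\<epsilon> i. \<epsilon> i * \<delta> i" and j="\<lambda>\<epsilon> i. \<epsilon> i * \<delta> i"])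
      (use E \<delta> in \<open>auto simp: sq sign_group_def sign_change_sign_change mult.assoc\<close>)
qed

text \<open>A sign change is a diagonal linear map in the standard basis with determinant \<open>\<plusminus>1\<close>.\<close>

lemma distr_lborel_sign_change:
  fixes \<epsilon> :: "'n::finite \<Rightarrow> real"
  assumes "\<epsilon> \<in> UNIV \<rightarrow> {-1, 1}"
  shows "distr lborel borel (sign_change \<epsilon>) = lborel"
proof -
  \<comment> \<open>the sign vector, indexed by the basis vectors instead of the coordinates\<close>
  define c where "c b = \<epsilon> (THE i. b = axis i 1)" for b :: "real^'n"
  have c: "c (axis i 1) = \<epsilon> i" for i unfolding c_def by (simp add: axis_eq_axis)
  have abs1: "\<bar>\<epsilon> i\<bar> = 1" for i using Pi_mem[OF assms, of i] by auto
  have cabs: "\<bar>c j\<bar> = 1" if "j \<in> Basis" for j using that c abs1 by (auto simp: Basis_vec_def)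
  have sc: "sign_change \<epsilon> x = 0 + (\<Sum>j\<in>Basis. (c j * (x \<bullet> j)) *\<^sub>R j)" for x
  proof (rule euclidean_eqI)
    fix b :: "real^'n" assume "b \<in> Basis"
    then have "(\<Sum>j\<in>Basis. (c j * (x \<bullet> j)) *\<^sub>R j) \<bullet> b = c b * (x \<bullet> b)" by simp
    moreover obtain i where "b = axis i 1" using \<open>b \<in> Basis\<close> by (auto simp: Basis_vec_def)
    ultimately show "sign_change \<epsilon> x \<bullet> b = (0 + (\<Sum>j\<in>Basis. (c j * (x \<bullet> j)) *\<^sub>R j)) \<bullet> b"
      by (simp only: add_0) (simp add: c inner_axis sign_change_def)
  qed
  have "lborel = density (distr lborel borel (\<lambda>x. 0 + (\<Sum>j\<in>Basis. (c j * (x \<bullet> j)) *\<^sub>R j)))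
      (\<lambda>_. ennreal (\<Prod>j\<in>Basis. \<bar>c j\<bar>))"
    using cabs by (intro lborel_affine_euclidean) force
  also have "(\<Prod>j\<in>Basis. \<bar>c j\<bar>) = 1" using cabs by simp
  finally show ?thesis unfolding sc[symmetric] by (simp add: density_1)
qed

lemma legendre_sign_change:
  assumes "\<epsilon> \<in> UNIV \<rightarrow> {-1, 1}"
  shows "legendre (\<lambda>x. f (sign_change \<epsilon> x)) y = legendre f (sign_change \<epsilon> y)"
proof -
  have surj: "surj (sign_change \<epsilon>)" by (metis assms sign_change_involution surjI)
  have "legendre f (sign_change \<epsilon> y)
      = (SUP x\<in>range (sign_change \<epsilon>). ereal (x \<bullet> sign_change \<epsilon> y) - f x)"
    unfolding legendre_def surj ..
  also have "\<dots> = legendre (\<lambda>x. f (sign_change \<epsilon> x)) y"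
    unfolding legendre_def image_image using assms by (simp add: inner_sign_change_both)
  finally show ?thesis ..
qed

lemma exp_mass_legendre_sign_change:
  assumes "\<epsilon> \<in> UNIV \<rightarrow> {-1, 1}"
  shows "exp_mass (legendre (\<lambda>x. f (sign_change \<epsilon> x))) = exp_mass (legendre f)"
proof -
  have "exp_mass (legendre f)
      = (\<integral>\<^sup>+y. exp_ereal (- legendre f y) \<partial>distr lborel borel (sign_change \<epsilon>))"
    unfolding exp_mass_def distr_lborel_sign_change[OF assms] ..
  also have "\<dots> = (\<integral>\<^sup>+y. exp_ereal (- legendre f (sign_change \<epsilon> y)) \<partial>lborel)"
    by (subst nn_integral_distr) auto
  finally show ?thesis unfolding exp_mass_def legendre_sign_change[OF assms] ..
qed

lemma legendre_inv:
  assumes E: "sign_group E" and inv: "\<And>\<epsilon> x. \<epsilon> \<in> E \<Longrightarrow> f (sign_change \<epsilon> x) = f x" and "\<epsilon> \<in> E"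
  shows "legendre f (sign_change \<epsilon> y) = legendre f y"
  using legendre_sign_change[OF sign_group_signs[OF E \<open>\<epsilon> \<in> E\<close>], of f y] inv[OF \<open>\<epsilon> \<in> E\<close>] by simp

section \<open>From the reverse Santalo inequality to the transport inequality\<close>

definition sign_mean :: "('n::finite \<Rightarrow> real) set \<Rightarrow> (real^'n \<Rightarrow> ereal) \<Rightarrow> real^'n \<Rightarrow> ereal" where
  "sign_mean E f x = ereal (1 / real (card E)) * (\<Sum>\<epsilon>\<in>E. f (sign_change \<epsilon> x))"

lemma sign_mean_real:
  assumes "\<And>\<epsilon>. \<epsilon> \<in> E \<Longrightarrow> f (sign_change \<epsilon> x) \<noteq> \<infinity> \<and> f (sign_change \<epsilon> x) \<noteq> -\<infinity>"
  shows "sign_mean E f x = ereal (1 / real (card E) * (\<Sum>\<epsilon>\<in>E. real_of_ereal (f (sign_change \<epsilon> x))))"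
proof -
  have "(\<Sum>\<epsilon>\<in>E. f (sign_change \<epsilon> x)) = (\<Sum>\<epsilon>\<in>E. ereal (real_of_ereal (f (sign_change \<epsilon> x))))"
    using assms by (intro sum.cong) (auto simp: ereal_real)
  then show ?thesis unfolding sign_mean_def by simp
qed

lemma sign_mean_infinite:
  assumes E: "sign_group E" and "\<And>x. f x \<noteq> -\<infinity>" and "\<epsilon> \<in> E" "f (sign_change \<epsilon> x) = \<infinity>"
  shows "sign_mean E f x = \<infinity>"
proof -
  have "(\<Sum>\<epsilon>\<in>E. f (sign_change \<epsilon> x)) = \<infinity>"
    using assms sign_group_finite[OF E] by (subst sum_Pinfty) auto
  then show ?thesis
    using sign_group_finite[OF E] by (simp add: sign_mean_def card_gt_0_iff)
qed

text \<open>By invariance of \<open>\<nu>\<close> each function \<open>x \<mapsto> f (sign_change \<epsilon> x)\<close> is integrable with the same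
integral as \<open>f\<close>. Here \<open>u\<close> is the almost everywhere finite version of \<^term>\<open>sign_mean E f\<close>.\<close>

lemma sign_mean_ae:
  fixes E :: "('n::finite \<Rightarrow> real) set"
  assumes E: "sign_group E" and \<nu>: "\<nu> \<in> prob1_inv E" and f: "f \<in> ereal_L1 \<nu>"
  defines "u \<equiv> \<lambda>x. 1 / real (card E) * (\<Sum>\<epsilon>\<in>E. real_of_ereal (f (sign_change \<epsilon> x)))"
  shows "AE x in \<nu>. \<forall>\<epsilon>\<in>E. f (sign_change \<epsilon> x) \<noteq> \<infinity> \<and> f (sign_change \<epsilon> x) \<noteq> -\<infinity>"
    and "integrable \<nu> u" "(\<integral>x. u x \<partial>\<nu>) = (\<integral>x. real_of_ereal (f x) \<partial>\<nu>)"
proof -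
  have P: "\<nu> \<in> prob1" and inv: "\<epsilon> \<in> E \<Longrightarrow> distr \<nu> borel (sign_change \<epsilon>) = \<nu>" for \<epsilon>
    using \<nu> by (auto simp: prob1_inv_def)
  note [measurable_cong] = prob1D(1)[OF P]
  have [measurable]: "f \<in> borel_measurable borel"
    using f prob1D(1)[OF P] measurable_cong_sets by (auto simp: ereal_L1_def)
  have "AE x in \<nu>. f (sign_change \<epsilon> x) \<noteq> \<infinity> \<and> f (sign_change \<epsilon> x) \<noteq> -\<infinity>" if "\<epsilon> \<in> E" for \<epsilon>
  proof -
    have "AE x in distr \<nu> borel (sign_change \<epsilon>). f x \<noteq> \<infinity> \<and> f x \<noteq> -\<infinity>"
      unfolding inv[OF that] by (rule ereal_L1_integrable(1)[OF f])
    then show ?thesis by (subst (asm) AE_distr_iff) auto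
  qed
  then show "AE x in \<nu>. \<forall>\<epsilon>\<in>E. f (sign_change \<epsilon> x) \<noteq> \<infinity> \<and> f (sign_change \<epsilon> x) \<noteq> -\<infinity>"
    using sign_group_finite[OF E] by (auto intro!: AE_finite_allI)
  have int: "integrable \<nu> (\<lambda>x. real_of_ereal (f (sign_change \<epsilon> x)))"
    and eq: "(\<integral>x. real_of_ereal (f (sign_change \<epsilon> x)) \<partial>\<nu>) = (\<integral>x. real_of_ereal (f x) \<partial>\<nu>)"
    if "\<epsilon> \<in> E" for \<epsilon>
  proof -
    have "integrable (distr \<nu> borel (sign_change \<epsilon>)) (\<lambda>x. real_of_ereal (f x))"
      unfolding inv[OF that] by (rule ereal_L1_integrable(2)[OF f])
    then show "integrable \<nu> (\<lambda>x. real_of_ereal (f (sign_change \<epsilon> x)))"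
      by (subst (asm) integrable_distr_eq) auto
    have "(\<integral>x. real_of_ereal (f x) \<partial>distr \<nu> borel (sign_change \<epsilon>))
        = (\<integral>x. real_of_ereal (f (sign_change \<epsilon> x)) \<partial>\<nu>)"
      by (subst integral_distr) auto
    then show "(\<integral>x. real_of_ereal (f (sign_change \<epsilon> x)) \<partial>\<nu>) = (\<integral>x. real_of_ereal (f x) \<partial>\<nu>)"
      unfolding inv[OF that] ..
  qed
  show "integrable \<nu> u" unfolding u_def using int by auto
  have "(\<integral>x. u x \<partial>\<nu>) = 1 / real (card E) * (\<Sum>\<epsilon>\<in>E. \<integral>x. real_of_ereal (f x) \<partial>\<nu>)"
    unfolding u_def using int eq by (simp add: Bochner_Integration.integral_sum)
  then show "(\<integral>x. u x \<partial>\<nu>) = (\<integral>x. real_of_ereal (f x) \<partial>\<nu>)"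
    using sign_group_finite[OF E] by simp
qed

text \<open>This averages the Fenchel-Young inequalities at the pairs \<open>(sign_change \<epsilon> x, sign_change \<epsilon> y)\<close>,
all of which have the same inner product \<open>x \<bullet> y\<close>.\<close>

lemma legendre_sign_mean_le:
  fixes E :: "('n::finite \<Rightarrow> real) set"
  assumes E: "sign_group E" and nM: "\<And>y. legendre f y \<noteq> -\<infinity>"
    and x: "\<And>\<epsilon>. \<epsilon> \<in> E \<Longrightarrow> f (sign_change \<epsilon> x) \<noteq> \<infinity> \<and> f (sign_change \<epsilon> x) \<noteq> -\<infinity>"
  shows "legendre (sign_mean E (legendre f)) x
    \<le> ereal (1 / real (card E) * (\<Sum>\<epsilon>\<in>E. real_of_ereal (f (sign_change \<epsilon> x))))"
  unfolding legendre_def[of "sign_mean E (legendre f)"]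
proof (rule SUP_least)
  fix y
  let ?N = "real (card E)"
  have N: "?N > 0" using sign_group_finite[OF E] by (simp add: card_gt_0_iff)
  show "ereal (y \<bullet> x) - sign_mean E (legendre f) y
      \<le> ereal (1 / ?N * (\<Sum>\<epsilon>\<in>E. real_of_ereal (f (sign_change \<epsilon> x))))"
  proof (cases "\<exists>\<epsilon>\<in>E. legendre f (sign_change \<epsilon> y) = \<infinity>")
    case True
    then have "sign_mean E (legendre f) y = \<infinity>" using sign_mean_infinite[OF E, of "legendre f" _ y] nM by blast
    then show ?thesis by simp
  next
    case False
    let ?F = "\<lambda>\<epsilon>. real_of_ereal (f (sign_change \<epsilon> x))"
    let ?L = "\<lambda>\<epsilon>. real_of_ereal (legendre f (sign_change \<epsilon> y))"
    have "y \<bullet> x \<le> ?F \<epsilon> + ?L \<epsilon>" if \<epsilon>: "\<epsilon> \<in> E" for \<epsilon>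
      using fenchel_young[of "sign_change \<epsilon> x" "sign_change \<epsilon> y" f] x[OF \<epsilon>] nM[of "sign_change \<epsilon> y"] False \<epsilon>
      by (cases "f (sign_change \<epsilon> x)"; cases "legendre f (sign_change \<epsilon> y)")
        (auto simp: inner_sign_change_both[OF sign_group_signs[OF E \<epsilon>]] inner_commute)
    then have "(\<Sum>\<epsilon>\<in>E. y \<bullet> x) \<le> (\<Sum>\<epsilon>\<in>E. ?F \<epsilon> + ?L \<epsilon>)" by (rule sum_mono)
    then have "?N * (y \<bullet> x) \<le> (\<Sum>\<epsilon>\<in>E. ?F \<epsilon>) + (\<Sum>\<epsilon>\<in>E. ?L \<epsilon>)" by (simp add: sum.distrib)
    then have "y \<bullet> x \<le> 1 / ?N * (\<Sum>\<epsilon>\<in>E. ?F \<epsilon>) + 1 / ?N * (\<Sum>\<epsilon>\<in>E. ?L \<epsilon>)"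
      using N by (simp add: pos_le_divide_eq add_divide_distrib[symmetric] mult.commute)
    then show ?thesis using False nM by (subst sign_mean_real) auto
  qed
qed

text \<open>It suffices to treat finite \<open>K_Leb \<nu>\<^sub>1\<close>, \<open>K_Leb \<nu>\<^sub>2\<close> and a competitor \<open>f\<close> of finite cost. Then \<open>f\<close> and
\<open>f\<^sup>*\<close> are integrable, as each has an affine minorant. Let \<open>k\<close> be the mean of \<open>f\<^sup>*\<close> over the group and
\<open>g = k\<^sup>*\<close>. Then \<open>g\<close> is invariant and lies in \<^term>\<open>lsc_convex\<close>, being a transform; moreover \<open>g\<close> is at
most the mean of \<open>f\<close>, and \<open>g\<^sup>* \<le> k\<close>. So the pair \<open>(g, g\<^sup>*)\<close> costs no more than \<open>(f, f\<^sup>*)\<close>, and the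
reverse Santalo inequality applies to \<open>g\<close>.\<close>

theorem entropy_transport_ineq_if_reverse_santalo:
  fixes E :: "('n::finite \<Rightarrow> real) set"
  assumes E: "sign_group E" and c: "c > 0"
    and IS: "reverse_santalo (lsc_convex_inv E) c"
    and \<nu>1: "\<nu>\<^sub>1 \<in> prob1_inv E" and \<nu>2: "\<nu>\<^sub>2 \<in> prob1_inv E"
  shows "entropy_transport_ineq c \<nu>\<^sub>1 \<nu>\<^sub>2"
proof (cases "K_Leb \<nu>\<^sub>1 = \<infinity> \<or> K_Leb \<nu>\<^sub>2 = \<infinity>")
  case True
  then have "K_Leb \<nu>\<^sub>1 + K_Leb \<nu>\<^sub>2 = \<infinity>" by auto
  then show ?thesis unfolding entropy_transport_ineq_def by (metis ereal_less_eq(1))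
next
  case K: False
  let ?C = "real CARD('n) * ln c"
  have P1: "\<nu>\<^sub>1 \<in> prob1" and P2: "\<nu>\<^sub>2 \<in> prob1" using \<nu>1 \<nu>2 by (auto simp: prob1_inv_def)
  interpret p1: prob_space \<nu>\<^sub>1 using prob1D[OF P1] by blast
  interpret p2: prob_space \<nu>\<^sub>2 using prob1D[OF P2] by blast
  have main: "K_Leb \<nu>\<^sub>1 \<noteq> -\<infinity> \<and> K_Leb \<nu>\<^sub>2 \<noteq> -\<infinity> \<and>
      ereal ?C \<le> K_Leb \<nu>\<^sub>1 + K_Leb \<nu>\<^sub>2 + (ereal_integral \<nu>\<^sub>1 f + ereal_integral \<nu>\<^sub>2 (legendre f))"
    if f: "f \<in> lsc_convex" and fin: "ereal_integral \<nu>\<^sub>1 f + ereal_integral \<nu>\<^sub>2 (legendre f) \<noteq> \<infinity>" for f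
  proof -
    have fin1: "ereal_integral \<nu>\<^sub>1 f < \<infinity>" and fin2: "ereal_integral \<nu>\<^sub>2 (legendre f) < \<infinity>"
      using fin by auto
    have fnM: "f x \<noteq> -\<infinity>" for x using f by (auto simp: lsc_convex_def)
    obtain x0 where x0: "f x0 \<noteq> \<infinity>" using f by (auto simp: lsc_convex_def)
    obtain y0 where y0: "legendre f y0 \<noteq> \<infinity>"
    proof -
      have "\<exists>y. legendre f y \<noteq> \<infinity>"
      proof (rule ccontr)
        assume "\<not> ?thesis"
        then have "ereal_integral \<nu>\<^sub>2 (legendre f) = \<infinity>"
          by (simp add: ereal_integral_def p2.emeasure_space_1 e2ennreal_neg)
        with fin2 show False by simp
      qed
      then show ?thesis using that by blast
    qed
    have LnM: "legendre f y \<noteq> -\<infinity>" for y using legendre_not_MInf x0 by blast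
    obtain r0 where r0: "f x0 = ereal r0" using x0 fnM[of x0] by (cases "f x0") auto
    obtain s0 where s0: "legendre f y0 = ereal s0" using y0 LnM[of y0] by (cases "legendre f y0") auto
    have L1f: "f \<in> ereal_L1 \<nu>\<^sub>1"
    proof (rule ereal_L1_minorant[OF _ prob1D(5)[OF P1]])
      show "ereal (x \<bullet> y0 + (- s0)) \<le> f x" for x
        using fenchel_young[of x y0 f] s0 by (cases "f x") auto
    qed (use prob1D[OF P1] lsc_convex_measurable[OF f] fin1 in auto)
    have L1L: "legendre f \<in> ereal_L1 \<nu>\<^sub>2"
    proof (rule ereal_L1_minorant[OF _ prob1D(5)[OF P2]])
      show "ereal (y \<bullet> x0 + (- r0)) \<le> legendre f y" for y
        using fenchel_young[of x0 y f] r0 by (simp add: inner_commute)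
    qed (use prob1D[OF P2] fin2 in auto)
    \<comment> \<open>Symmetrization takes place on the dual side, so that \<open>g\<close> is a Legendre transform.\<close>
    define k where "k = sign_mean E (legendre f)"
    define g where "g = legendre k"
    let ?u1 = "\<lambda>x. 1 / real (card E) * (\<Sum>\<epsilon>\<in>E. real_of_ereal (f (sign_change \<epsilon> x)))"
    let ?u2 = "\<lambda>x. 1 / real (card E) * (\<Sum>\<epsilon>\<in>E. real_of_ereal (legendre f (sign_change \<epsilon> x)))"
    have u1: "AE x in \<nu>\<^sub>1. g x \<le> ereal (?u1 x)"
      using sign_mean_ae(1)[OF E \<nu>1 L1f]
      by eventually_elim (unfold g_def k_def, rule legendre_sign_mean_le[OF E LnM], blast)
    have keq: "AE y in \<nu>\<^sub>2. k y = ereal (?u2 y)"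
      using sign_mean_ae(1)[OF E \<nu>2 L1L]
      by eventually_elim (unfold k_def, rule sign_mean_real, blast)
    have u2: "AE y in \<nu>\<^sub>2. legendre g y \<le> ereal (?u2 y)"
      using keq by eventually_elim (metis g_def legendre_legendre_le)
    obtain x1 where x1: "g x1 \<noteq> \<infinity>"
    proof -
      have "\<exists>x. g x \<noteq> \<infinity>"
      proof (rule ccontr)
        assume "\<not> ?thesis"
        with u1 have "AE x in \<nu>\<^sub>1. False" by simp
        then show False by simp
      qed
      then show ?thesis using that by blast
    qed
    obtain y1 where y1: "k y1 \<noteq> \<infinity>"
    proof -
      have "\<exists>y. k y \<noteq> \<infinity>"
      proof (rule ccontr)
        assume "\<not> ?thesis"
        with keq have "AE y in \<nu>\<^sub>2. False" by simp
        then show False by simp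
      qed
      then show ?thesis using that by blast
    qed
    have "k y1 \<noteq> -\<infinity>"
      using fenchel_young[of y1 x1 k] x1 by (auto simp: g_def)
    then obtain t1 where t1: "k y1 = ereal t1" using y1 by (cases "k y1") auto
    have "g x1 \<noteq> -\<infinity>" unfolding g_def using legendre_not_MInf y1 by blast
    then obtain q1 where q1: "g x1 = ereal q1" using x1 by (cases "g x1") auto
    have g: "g \<in> lsc_convex"
      using x1 y1 unfolding g_def by (intro legendre_in_lsc_convex[of k y1 x1])
    have "legendre g y1 \<noteq> \<infinity>" using y1 legendre_legendre_le[of k y1] by (auto simp: g_def)
    with x1 have Lg: "legendre g \<in> lsc_convex" by (rule legendre_in_lsc_convex)
    have "k (sign_change \<epsilon> y) = k y" if "\<epsilon> \<in> E" for \<epsilon> y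
      unfolding k_def sign_mean_def sum_sign_group_shift[OF E that] ..
    then have g_inv: "g \<in> lsc_convex_inv E"
      using g legendre_inv[OF E, of k] by (auto simp: lsc_convex_inv_def g_def)
    have L1g: "g \<in> ereal_L1 \<nu>\<^sub>1" "ereal_integral \<nu>\<^sub>1 (\<lambda>x. - g x) \<ge> ereal (- (\<integral>x. ?u1 x \<partial>\<nu>\<^sub>1))"
    proof -
      have "ereal (x \<bullet> y1 + (- t1)) \<le> g x" for x
        using fenchel_young[of y1 x k] t1 by (simp add: g_def inner_commute)
      then have ae: "AE x in \<nu>\<^sub>1. ereal (x \<bullet> y1 + (- t1)) \<le> g x \<and> g x \<le> ereal (?u1 x)"
        using u1 by simp
      note sw = ereal_L1_sandwich[OF prob1D(6)[OF P1 lsc_convex_measurable[OF g]] prob1D(5)[OF P1]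
          sign_mean_ae(2)[OF E \<nu>1 L1f] ae]
      show "g \<in> ereal_L1 \<nu>\<^sub>1" "ereal_integral \<nu>\<^sub>1 (\<lambda>x. - g x) \<ge> ereal (- (\<integral>x. ?u1 x \<partial>\<nu>\<^sub>1))"
        using sw by blast+
    qed
    have L1Lg: "legendre g \<in> ereal_L1 \<nu>\<^sub>2"
      "ereal_integral \<nu>\<^sub>2 (\<lambda>x. - legendre g x) \<ge> ereal (- (\<integral>x. ?u2 x \<partial>\<nu>\<^sub>2))"
    proof -
      have "ereal (y \<bullet> x1 + (- q1)) \<le> legendre g y" for y
        using fenchel_young[of x1 y g] q1 by (simp add: inner_commute)
      then have ae: "AE y in \<nu>\<^sub>2. ereal (y \<bullet> x1 + (- q1)) \<le> legendre g y \<and> legendre g y \<le> ereal (?u2 y)"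
        using u2 by simp
      note sw = ereal_L1_sandwich[OF prob1D(6)[OF P2 lsc_convex_measurable[OF Lg]] prob1D(5)[OF P2]
          sign_mean_ae(2)[OF E \<nu>2 L1L] ae]
      show "legendre g \<in> ereal_L1 \<nu>\<^sub>2"
        "ereal_integral \<nu>\<^sub>2 (\<lambda>x. - legendre g x) \<ge> ereal (- (\<integral>x. ?u2 x \<partial>\<nu>\<^sub>2))"
        using sw by blast+
    qed
    define i1 where "i1 = (\<integral>x. real_of_ereal (f x) \<partial>\<nu>\<^sub>1)"
    define i2 where "i2 = (\<integral>x. real_of_ereal (legendre f x) \<partial>\<nu>\<^sub>2)"
    have K1: "ereal (- i1) + log_ennreal (exp_mass (legendre g)) \<le> K_Leb \<nu>\<^sub>1"
      using L1g(2) unfolding sign_mean_ae(3)[OF E \<nu>1 L1f] i1_def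
      by (intro order_trans[OF add_right_mono K_Leb_ge[OF L1g(1) g]])
    have K2: "ereal (- i2) + log_ennreal (exp_mass g) \<le> K_Leb \<nu>\<^sub>2"
      using L1Lg(2) unfolding sign_mean_ae(3)[OF E \<nu>2 L1L] i2_def
      by (intro order_trans[OF add_mono K_Leb_ge[OF L1Lg(1) Lg]] log_ennreal_mono exp_mass_antimono
          legendre_legendre_le)
    \<comment> \<open>A vanishing mass would make one of the \<open>K_Leb\<close> infinite.\<close>
    have "AE x in \<nu>\<^sub>1. g x \<noteq> \<infinity>" using u1 by eventually_elim auto
    then have "exp_mass g \<noteq> 0" using K_Leb_infinite_if_exp_mass_0[OF P1 g] K by blast
    moreover have "AE y in \<nu>\<^sub>2. legendre g y \<noteq> \<infinity>" using u2 by eventually_elim auto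
    then have "exp_mass (legendre g) \<noteq> 0" using K_Leb_infinite_if_exp_mass_0[OF P2 Lg] K by blast
    moreover have "exp_mass g \<noteq> \<infinity>" "exp_mass (legendre g) \<noteq> \<infinity>"
      using K1 K2 K by (auto simp: log_ennreal_def)
    ultimately obtain A B where A: "exp_mass g = ennreal A" "A > 0"
      and B: "exp_mass (legendre g) = ennreal B" "B > 0"
      by (metis ennreal_cases ennreal_0 infinity_ennreal_def order_le_less)
    have logs: "log_ennreal (exp_mass g) = ereal (ln A)" "log_ennreal (exp_mass (legendre g)) = ereal (ln B)"
      using A B by (auto simp: log_ennreal_def)
    have "ennreal (c ^ CARD('n)) \<le> exp_mass g * exp_mass (legendre g)"
      using IS g_inv A B unfolding reverse_santalo_def by auto
    then have "c ^ CARD('n) \<le> A * B"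
      using A B by (simp add: ennreal_mult[symmetric] ennreal_le_iff)
    then have "ln (c ^ CARD('n)) \<le> ln (A * B)" using c A B by simp
    then have C: "?C \<le> ln A + ln B" using c A B by (simp add: ln_realpow ln_mult)
    have "ereal_integral \<nu>\<^sub>1 f + ereal_integral \<nu>\<^sub>2 (legendre f) = ereal (i1 + i2)"
      by (simp add: ereal_L1_integrable(3)[OF L1f] ereal_L1_integrable(3)[OF L1L] i1_def i2_def)
    then show ?thesis
      using K1 K2 K C unfolding logs by (cases "K_Leb \<nu>\<^sub>1"; cases "K_Leb \<nu>\<^sub>2") auto
  qed
  show ?thesis
  proof (cases "\<exists>f\<in>lsc_convex. ereal_integral \<nu>\<^sub>1 f + ereal_integral \<nu>\<^sub>2 (legendre f) \<noteq> \<infinity>")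
    case False
    then have "transport \<nu>\<^sub>1 \<nu>\<^sub>2 = \<infinity>"
      unfolding transport_def by (auto simp: INF_eq_iff top_ereal_def intro!: antisym INF_greatest)
    then show ?thesis by (simp add: entropy_transport_ineq_def)
  next
    case True
    then obtain k1 k2 where k: "K_Leb \<nu>\<^sub>1 = ereal k1" "K_Leb \<nu>\<^sub>2 = ereal k2"
      using main K by (cases "K_Leb \<nu>\<^sub>1"; cases "K_Leb \<nu>\<^sub>2") auto
    have "ereal (?C - (k1 + k2)) \<le> transport \<nu>\<^sub>1 \<nu>\<^sub>2"
      unfolding transport_def
    proof (rule INF_greatest)
      fix f :: "real^'n \<Rightarrow> ereal" assume "f \<in> lsc_convex"
      then show "ereal (?C - (k1 + k2)) \<le> ereal_integral \<nu>\<^sub>1 f + ereal_integral \<nu>\<^sub>2 (legendre f)"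
        using main[of f] k
        by (cases "ereal_integral \<nu>\<^sub>1 f + ereal_integral \<nu>\<^sub>2 (legendre f)") (auto simp: algebra_simps)
    qed
    then show ?thesis
      unfolding entropy_transport_ineq_def k by (cases "transport \<nu>\<^sub>1 \<nu>\<^sub>2") auto
  qed
qed

section \<open>Exponential masses of polyhedral functions\<close>

text \<open>This is the Legendre transform of the function that equals \<open>a\<close> on the finite set \<open>S\<close> and \<open>\<infinity>\<close>
elsewhere.\<close>

definition max_affine :: "'a::euclidean_space set \<Rightarrow> ('a \<Rightarrow> real) \<Rightarrow> 'a \<Rightarrow> real" where
  "max_affine S a y = Max ((\<lambda>x. x \<bullet> y - a x) ` S)"

definition max_affine_mass :: "'a::euclidean_space set \<Rightarrow> ('a \<Rightarrow> real) \<Rightarrow> ennreal" where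
  "max_affine_mass S a = (\<integral>\<^sup>+y. ennreal (exp (- max_affine S a y)) \<partial>lborel)"

lemma borel_measurable_max_affine [measurable]:
  "finite S \<Longrightarrow> max_affine S a \<in> borel_measurable borel"
  unfolding max_affine_def[abs_def] by measurable

lemma max_affine_ge: "finite S \<Longrightarrow> x \<in> S \<Longrightarrow> x \<bullet> y - a x \<le> max_affine S a y"
  unfolding max_affine_def by (rule Max_ge) auto

lemma max_affine_le: "finite S \<Longrightarrow> S \<noteq> {} \<Longrightarrow> (\<And>x. x \<in> S \<Longrightarrow> x \<bullet> y - a x \<le> r) \<Longrightarrow> max_affine S a y \<le> r"
  unfolding max_affine_def by (rule Max.boundedI) auto

lemma max_affine_mono: "finite S \<Longrightarrow> T \<subseteq> S \<Longrightarrow> T \<noteq> {} \<Longrightarrow> max_affine T a y \<le> max_affine S a y"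
  by (intro max_affine_le max_affine_ge) (auto intro: finite_subset)

text \<open>The function \<^term>\<open>max_affine S a y\<close> is jointly convex in \<open>(a, y)\<close>, so its exponential mass is a
log-concave function of \<open>a\<close>.\<close>

lemma max_affine_mass_midpoint:
  assumes S: "finite S" "S \<noteq> {}"
  shows "max_affine_mass S a * max_affine_mass S b \<le> (max_affine_mass S (\<lambda>x. (a x + b x) / 2))\<^sup>2"
  unfolding max_affine_mass_def
proof (rule prekopa_leindler_midpoint)
  fix y z
  have "max_affine S (\<lambda>x. (a x + b x) / 2) ((1/2) *\<^sub>R (y + z)) \<le> (max_affine S a y + max_affine S b z) / 2"
  proof (rule max_affine_le[OF S])
    fix x assume "x \<in> S"
    then show "x \<bullet> ((1/2) *\<^sub>R (y + z)) - (a x + b x) / 2 \<le> (max_affine S a y + max_affine S b z) / 2"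
      using max_affine_ge[OF S(1), of x y a] max_affine_ge[OF S(1), of x z b]
      by (simp add: inner_add_right field_simps)
  qed
  then have "exp (- max_affine S a y) * exp (- max_affine S b z)
      \<le> (exp (- max_affine S (\<lambda>x. (a x + b x) / 2) ((1/2) *\<^sub>R (y + z))))\<^sup>2"
    by (simp add: power2_eq_square mult_exp_exp)
  then show "ennreal (exp (- max_affine S a y)) * ennreal (exp (- max_affine S b z))
      \<le> (ennreal (exp (- max_affine S (\<lambda>x. (a x + b x) / 2) ((1/2) *\<^sub>R (y + z)))))\<^sup>2"
    by (simp add: ennreal_mult[symmetric] ennreal_power ennreal_leI)
qed (use S in auto)

text \<open>Think of \<open>\<rho> k = R (1 / 2 ^ k)\<close> for a log-concave \<open>R\<close> with \<open>R 0 = 1\<close>. Then \<open>2 ^ k * ln (\<rho> k)\<close> increases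
with \<open>k\<close>, towards the derivative of \<open>ln R\<close> at 0, which the upper bound on \<open>\<rho> k\<close> estimates by
\<open>(\<Sum>x\<in>S. p x * d x)\<close>.\<close>

lemma dyadic_log_concave_bound:
  fixes \<rho> :: "nat \<Rightarrow> real" and p d :: "'i \<Rightarrow> real"
  assumes S: "finite S" and nonneg: "\<And>k. 0 \<le> \<rho> k" and sq: "\<And>k. \<rho> k \<le> (\<rho> (Suc k))\<^sup>2"
    and bound: "\<And>k. \<rho> k \<le> (\<Sum>x\<in>S. p x * exp (d x / 2 ^ k))"
    and p: "(\<Sum>x\<in>S. p x) = 1"
  shows "\<rho> 0 \<le> exp (\<Sum>x\<in>S. p x * d x)"
proof (cases "\<rho> 0 = 0")
  case False
  have pos: "\<rho> k > 0" for k
  proof (induction k)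
    case 0
    then show ?case using nonneg[of 0] False by simp
  next
    case (Suc k)
    then show ?case using sq[of k] nonneg[of "Suc k"] by (cases "\<rho> (Suc k) = 0") auto
  qed
  have ln_le: "ln (\<rho> 0) \<le> 2 ^ k * ln (\<rho> k)" for k
  proof (induction k)
    case (Suc k)
    have "ln (\<rho> k) \<le> ln ((\<rho> (Suc k))\<^sup>2)" using sq[of k] pos[of k] pos[of "Suc k"]
      by (subst ln_le_cancel_iff) auto
    then have "2 ^ k * ln (\<rho> k) \<le> 2 ^ k * (2 * ln (\<rho> (Suc k)))"
      using pos by (intro mult_left_mono) (auto simp: ln_realpow)
    with Suc have "ln (\<rho> 0) \<le> 2 ^ k * (2 * ln (\<rho> (Suc k)))" by (rule order_trans)
    then show ?case by (simp add: mult_ac)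
  qed simp
  have upper: "ln (\<rho> 0) \<le> (\<Sum>x\<in>S. p x * ((exp (d x * (1 / 2 ^ k)) - 1) / (1 / 2 ^ k)))" for k
  proof -
    have "ln (\<rho> k) \<le> \<rho> k - 1" by (rule ln_le_minus_one[OF pos])
    also have "\<dots> \<le> (\<Sum>x\<in>S. p x * exp (d x / 2 ^ k)) - (\<Sum>x\<in>S. p x)" using bound[of k] p by simp
    also have "\<dots> = (\<Sum>x\<in>S. p x * (exp (d x / 2 ^ k) - 1))"
      by (simp add: sum_subtractf right_diff_distrib)
    finally have "2 ^ k * ln (\<rho> k) \<le> 2 ^ k * (\<Sum>x\<in>S. p x * (exp (d x / 2 ^ k) - 1))"
      by (intro mult_left_mono) auto
    with ln_le[of k] show ?thesis by (simp add: sum_distrib_left mult_ac)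
  qed
  have lim: "(\<lambda>k. (exp (c * (1 / 2 ^ k)) - 1) / (1 / 2 ^ k)) \<longlonglongrightarrow> c" for c :: real
  proof -
    have "((\<lambda>s. exp (c * s)) has_real_derivative c) (at 0)"
      by (auto intro!: derivative_eq_intros)
    then have "((\<lambda>s. (exp (c * s) - 1) / s) \<longlongrightarrow> c) (at 0)"
      by (simp add: has_field_derivative_iff)
    moreover have "filterlim (\<lambda>k. 1 / 2 ^ k :: real) (at 0) sequentially"
      unfolding filterlim_at using LIMSEQ_divide_realpow_zero[of 2 1] by auto
    ultimately show ?thesis by (rule filterlim_compose)
  qed
  have "(\<lambda>k. \<Sum>x\<in>S. p x * ((exp (d x * (1 / 2 ^ k)) - 1) / (1 / 2 ^ k))) \<longlonglongrightarrow> (\<Sum>x\<in>S. p x * d x)"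
    by (intro tendsto_sum tendsto_mult lim tendsto_const)
  then have "ln (\<rho> 0) \<le> (\<Sum>x\<in>S. p x * d x)"
    using upper by (intro LIMSEQ_le_const) auto
  then have "exp (ln (\<rho> 0)) \<le> exp (\<Sum>x\<in>S. p x * d x)" by (subst exp_le_cancel_iff)
  then show ?thesis using pos[of 0] by simp
qed simp

lemma max_affine_mass_pos:
  assumes "finite S"
  shows "max_affine_mass S a \<noteq> 0"
proof
  assume "max_affine_mass S a = 0"
  then have "AE y in lborel. ennreal (exp (- max_affine S a y)) = 0"
    using assms unfolding max_affine_mass_def by (subst (asm) nn_integral_0_iff_AE) auto
  then have "AE y::'a in lborel. False" by simp
  then have "emeasure lborel (UNIV :: 'a set) = 0" by (simp add: AE_iff_measurable[OF _ refl])
  then show False by simp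
qed

text \<open>The weights are a measurable partition of unity subordinate to the cells on which the affine
functions are maximal. Ties are shared equally, which spares a choice among the maximizers.\<close>

definition argmax_weight :: "'a::euclidean_space set \<Rightarrow> ('a \<Rightarrow> real) \<Rightarrow> 'a \<Rightarrow> 'a \<Rightarrow> real" where
  "argmax_weight S a x y = of_bool (x \<bullet> y - a x = max_affine S a y)
     / (\<Sum>z\<in>S. of_bool (z \<bullet> y - a z = max_affine S a y))"

lemma borel_measurable_argmax_weight [measurable]:
  "finite S \<Longrightarrow> argmax_weight S a x \<in> borel_measurable borel"
  unfolding argmax_weight_def[abs_def] of_bool_def by measurable

lemma argmax_weight:
  assumes S: "finite S" "S \<noteq> {}"
  shows "0 \<le> argmax_weight S a x y" "(\<Sum>x\<in>S. argmax_weight S a x y) = 1"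
    "argmax_weight S a x y \<noteq> 0 \<Longrightarrow> x \<bullet> y - a x = max_affine S a y"
proof -
  have nn: "0 \<le> (\<Sum>z\<in>S. of_bool (z \<bullet> y - a z = max_affine S a y) :: real)" by (intro sum_nonneg) auto
  then show "0 \<le> argmax_weight S a x y" by (simp add: argmax_weight_def)
  have "max_affine S a y \<in> (\<lambda>x. x \<bullet> y - a x) ` S" unfolding max_affine_def using S by (intro Max_in) auto
  then have "(\<Sum>z\<in>S. of_bool (z \<bullet> y - a z = max_affine S a y) :: real) \<noteq> 0"
    using S by (subst sum_nonneg_eq_0_iff) auto
  then show "(\<Sum>x\<in>S. argmax_weight S a x y) = 1"
    unfolding argmax_weight_def sum_divide_distrib[symmetric] by simp
  show "argmax_weight S a x y \<noteq> 0 \<Longrightarrow> x \<bullet> y - a x = max_affine S a y"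
    by (auto simp: argmax_weight_def)
qed

text \<open>Under the density \<open>exp (- max_affine S F y) / z\<close>, let \<open>P x\<close> be the expectation of the weight of \<open>x\<close>.
Where the affine function of \<open>x\<close> is maximal, changing \<open>F\<close> to \<open>F + d\<close> lowers the maximum by at most
\<open>d x\<close>; integrating this bound over the cells gives
\<open>max_affine_mass T (F + d) \<le> z * (\<Sum>x\<in>T. P x * exp (d x))\<close>. Taking \<open>d = (b - F) / 2 ^ k\<close>, this is an
upper bound on the derivative of the logarithm of the mass at \<open>F\<close>, and log-concavity turns it into
an estimate at \<open>b\<close>. The set \<open>T\<close> of points of positive probability takes the place of \<open>S\<close> because a
competitor is only known to be finite where the measure has atoms; the other cells are null sets.\<close>

theorem max_affine_mass_tangent:
  fixes F :: "'a::euclidean_space \<Rightarrow> real"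
  assumes S: "finite S" "S \<noteq> {}" and z: "max_affine_mass S F = ennreal z" "z > 0"
  obtains p :: "'a pmf" where "set_pmf p \<subseteq> S"
    and "\<And>b. max_affine_mass (set_pmf p) b \<le> ennreal (z * exp (\<Sum>x\<in>set_pmf p. pmf p x * (b x - F x)))"
proof -
  note [measurable] = borel_measurable_max_affine[OF S(1)] borel_measurable_argmax_weight[OF S(1)]
  let ?w = "argmax_weight S F"
  let ?e = "\<lambda>y. exp (- max_affine S F y)"
  let ?I = "\<lambda>x. \<integral>\<^sup>+y. ennreal (?w x y * ?e y) \<partial>lborel"
  have w0: "0 \<le> ?w x y" for x y using argmax_weight[OF S] by blast
  have "(\<Sum>x\<in>S. ?I x) = (\<integral>\<^sup>+y. (\<Sum>x\<in>S. ennreal (?w x y * ?e y)) \<partial>lborel)"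
    by (rule nn_integral_sum[symmetric]) auto
  also have "\<dots> = (\<integral>\<^sup>+y. ennreal (?e y) \<partial>lborel)"
  proof (intro nn_integral_cong)
    fix y
    have "(\<Sum>x\<in>S. ?w x y * ?e y) = ?e y"
      by (simp add: sum_distrib_right[symmetric] argmax_weight(2)[OF S])
    then show "(\<Sum>x\<in>S. ennreal (?w x y * ?e y)) = ennreal (?e y)"
      using w0 by (subst sum_ennreal) auto
  qed
  finally have sumI: "(\<Sum>x\<in>S. ?I x) = ennreal z" using z by (simp add: max_affine_mass_def)
  have I_le: "?I x \<le> ennreal z" if "x \<in> S" for x
    unfolding sumI[symmetric] using S that by (intro member_le_sum) auto
  define P where "P x = (if x \<in> S then enn2real (?I x) / z else 0)" for x
  have IP: "?I x = ennreal (z * P x)" if "x \<in> S" for x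
    using I_le[OF that] z(2) that by (cases "?I x") (auto simp: P_def top_unique)
  have P0: "0 \<le> P x" for x using z by (simp add: P_def)
  have "ennreal (\<Sum>x\<in>S. z * P x) = ennreal z"
    using sumI IP z P0 by (subst sum_ennreal[symmetric]) auto
  then have "(\<Sum>x\<in>S. z * P x) = z" using z P0 by (subst (asm) ennreal_inj) (auto intro: sum_nonneg)
  then have sumP: "(\<Sum>x\<in>S. P x) = 1" using z by (simp add: sum_distrib_left[symmetric])
  define p where "p = embed_pmf P"
  have "(\<integral>\<^sup>+x. ennreal (P x) \<partial>count_space UNIV) = (\<Sum>x\<in>S. ennreal (P x))"
    by (rule nn_integral_count_space'[OF S(1)]) (auto simp: P_def)
  also have "\<dots> = 1" using P0 sumP by (simp add: sum_ennreal)
  finally have nnP: "(\<integral>\<^sup>+x. ennreal (P x) \<partial>count_space UNIV) = 1" .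
  have pmfP: "pmf p x = P x" for x unfolding p_def by (rule pmf_embed_pmf[OF P0 nnP])
  have setp: "set_pmf p = {x. P x \<noteq> 0}" unfolding p_def by (rule set_embed_pmf[OF P0 nnP])
  let ?T = "set_pmf p"
  have T: "?T \<subseteq> S" by (auto simp: setp P_def split: if_splits)
  then have T: "?T \<subseteq> S" "finite ?T" "?T \<noteq> {}"
    using finite_subset[OF _ S(1)] set_pmf_not_empty by auto
  have sumT: "(\<Sum>x\<in>?T. P x) = 1"
    using sumP sum.mono_neutral_left[OF S(1) T(1), of P] by (auto simp: setp)
  have ae: "AE y in lborel. \<forall>x\<in>S - ?T. ?w x y = 0"
  proof (rule AE_finite_allI)
    fix x assume x: "x \<in> S - ?T"
    then have "?I x = 0" using IP[of x] by (simp add: setp)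
    then have "AE y in lborel. ennreal (?w x y * ?e y) = 0"
      by (subst (asm) nn_integral_0_iff_AE) auto
    then show "AE y in lborel. ?w x y = 0"
      by eventually_elim (use w0 in \<open>auto simp: ennreal_eq_0_iff mult_le_0_iff intro: antisym\<close>)
  qed (use S in auto)
  have first_order: "max_affine_mass ?T (\<lambda>x. F x + d x) \<le> ennreal (z * (\<Sum>x\<in>?T. P x * exp (d x)))" for d
  proof -
    have "max_affine_mass ?T (\<lambda>x. F x + d x)
        \<le> (\<integral>\<^sup>+y. (\<Sum>x\<in>?T. ennreal (exp (d x)) * ennreal (?w x y * ?e y)) \<partial>lborel)"
      unfolding max_affine_mass_def
    proof (rule nn_integral_mono_AE)
      show "AE y in lborel. ennreal (exp (- max_affine ?T (\<lambda>x. F x + d x) y))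
          \<le> (\<Sum>x\<in>?T. ennreal (exp (d x)) * ennreal (?w x y * ?e y))"
        using ae
      proof eventually_elim
        case (elim y)
        let ?m = "exp (- max_affine ?T (\<lambda>x. F x + d x) y)"
        have "(\<Sum>x\<in>?T. ?w x y) = (\<Sum>x\<in>S. ?w x y)"
          using elim by (intro sum.mono_neutral_left S T) auto
        then have "?m = (\<Sum>x\<in>?T. ?w x y * ?m)"
          by (simp add: sum_distrib_right[symmetric] argmax_weight(2)[OF S])
        also have "\<dots> \<le> (\<Sum>x\<in>?T. exp (d x) * (?w x y * ?e y))"
        proof (rule sum_mono)
          fix x assume x: "x \<in> ?T"
          show "?w x y * ?m \<le> exp (d x) * (?w x y * ?e y)"
          proof (cases "?w x y = 0")
            case False
            then have "x \<bullet> y - F x = max_affine S F y" by (rule argmax_weight(3)[OF S])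
            with max_affine_ge[OF T(2) x, of y "\<lambda>x. F x + d x"]
            have "?m \<le> exp (d x) * ?e y" by (simp add: mult_exp_exp)
            then have "?w x y * ?m \<le> ?w x y * (exp (d x) * ?e y)" using w0 by (rule mult_left_mono)
            then show ?thesis by (simp add: mult_ac)
          qed simp
        qed
        finally have "ennreal ?m \<le> ennreal (\<Sum>x\<in>?T. exp (d x) * (?w x y * ?e y))" by (rule ennreal_leI)
        also have "\<dots> = (\<Sum>x\<in>?T. ennreal (exp (d x)) * ennreal (?w x y * ?e y))"
          using w0 by (subst sum_ennreal[symmetric]) (auto simp: ennreal_mult)
        finally show ?case .
      qed
    qed
    also have "\<dots> = (\<Sum>x\<in>?T. ennreal (exp (d x)) * ?I x)"
      by (subst nn_integral_sum) (auto simp: nn_integral_cmult)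
    also have "\<dots> = (\<Sum>x\<in>?T. ennreal (z * (P x * exp (d x))))"
      using IP T(1) P0 z by (intro sum.cong) (auto simp: ennreal_mult[symmetric] mult_ac)
    also have "\<dots> = ennreal (z * (\<Sum>x\<in>?T. P x * exp (d x)))"
      using P0 z by (subst sum_ennreal) (auto simp: sum_distrib_left)
    finally show ?thesis .
  qed
  have "max_affine_mass ?T b \<le> ennreal (z * exp (\<Sum>x\<in>?T. pmf p x * (b x - F x)))" for b
  proof -
    \<comment> \<open>masses at the points \<open>F + t * (b - F)\<close> for \<open>t = 1 / 2 ^ k\<close>\<close>
    define R where "R k = max_affine_mass ?T (\<lambda>x. F x + (b x - F x) / 2 ^ k)" for k :: nat
    have R_le: "R k \<le> ennreal (z * (\<Sum>x\<in>?T. P x * exp ((b x - F x) / 2 ^ k)))" for k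
      unfolding R_def by (rule first_order)
    define \<rho> where "\<rho> k = enn2real (R k) / z" for k
    have R\<rho>: "R k = ennreal (z * \<rho> k)" for k
      using R_le[of k] z(2) by (cases "R k") (auto simp: \<rho>_def top_unique)
    have \<rho>0: "0 \<le> \<rho> k" for k using z by (simp add: \<rho>_def)
    have "\<rho> k \<le> (\<rho> (Suc k))\<^sup>2" for k
    proof -
      have "ennreal z \<le> max_affine_mass ?T F"
        unfolding z(1)[symmetric] max_affine_mass_def
        using max_affine_mono[OF S(1) T(1) T(3)] by (intro nn_integral_mono ennreal_leI) auto
      then have "ennreal z * R k \<le> max_affine_mass ?T F * R k" by (rule mult_right_mono) simp
      also have "\<dots> \<le> (max_affine_mass ?T (\<lambda>x. (F x + (F x + (b x - F x) / 2 ^ k)) / 2))\<^sup>2"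
        unfolding R_def by (rule max_affine_mass_midpoint[OF T(2,3)])
      also have "(\<lambda>x. (F x + (F x + (b x - F x) / 2 ^ k)) / 2) = (\<lambda>x. F x + (b x - F x) / 2 ^ Suc k)"
        by (auto simp: fun_eq_iff field_simps)
      finally have "ennreal z * R k \<le> (R (Suc k))\<^sup>2" unfolding R_def .
      then have "z * (z * \<rho> k) \<le> (z * \<rho> (Suc k))\<^sup>2"
        unfolding R\<rho> using z \<rho>0 by (simp add: ennreal_mult[symmetric] ennreal_power ennreal_le_iff)
      then have "z\<^sup>2 * \<rho> k \<le> z\<^sup>2 * (\<rho> (Suc k))\<^sup>2" by (simp add: power2_eq_square mult_ac)
      then show ?thesis using z by simp
    qed
    moreover have "\<rho> k \<le> (\<Sum>x\<in>?T. P x * exp ((b x - F x) / 2 ^ k))" for k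
    proof -
      have "z * \<rho> k \<le> z * (\<Sum>x\<in>?T. P x * exp ((b x - F x) / 2 ^ k))"
        using R_le[of k] z P0 unfolding R\<rho> by (subst (asm) ennreal_le_iff) (auto intro!: mult_nonneg_nonneg sum_nonneg)
      then show ?thesis using z by simp
    qed
    ultimately have "\<rho> 0 \<le> exp (\<Sum>x\<in>?T. P x * (b x - F x))"
      using \<rho>0 by (intro dyadic_log_concave_bound[OF T(2) _ _ _ sumT]) auto
    then have "R 0 \<le> ennreal (z * exp (\<Sum>x\<in>?T. P x * (b x - F x)))"
      unfolding R\<rho> using z by (intro ennreal_leI) auto
    then show ?thesis by (simp add: R_def pmfP)
  qed
  with T(1) that show thesis by blast
qed

section \<open>Polyhedral approximation of a Legendre transform\<close>

lemma nn_integral_exp_neg_abs_finite: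
  fixes \<alpha> :: real
  assumes "\<alpha> > 0"
  shows "(\<integral>\<^sup>+t. ennreal (exp (- \<alpha> * \<bar>t\<bar>)) \<partial>lborel) < \<infinity>"
proof -
  let ?d = "exponential_density \<alpha>"
  have one: "(\<integral>\<^sup>+t. ennreal (?d t) \<partial>lborel) = 1"
    using prob_space.emeasure_space_1[OF prob_space_exponential_density[OF assms]]
    by (simp add: emeasure_density)
  have two: "(\<integral>\<^sup>+t. ennreal (?d (- t)) \<partial>lborel) = 1"
    using nn_integral_real_affine[of "\<lambda>t. ennreal (?d t)" "-1" 0] one by simp
  have "(\<integral>\<^sup>+t. ennreal (exp (- \<alpha> * \<bar>t\<bar>)) \<partial>lborel)
      \<le> (\<integral>\<^sup>+t. ennreal (1 / \<alpha>) * (ennreal (?d t) + ennreal (?d (- t))) \<partial>lborel)"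
  proof (rule nn_integral_mono)
    fix t :: real
    have "exp (- \<alpha> * \<bar>t\<bar>) \<le> 1 / \<alpha> * (?d t + ?d (- t))"
      using assms by (auto simp: exponential_density_def mult.commute field_simps abs_if)
    then have "ennreal (exp (- \<alpha> * \<bar>t\<bar>)) \<le> ennreal (1 / \<alpha> * (?d t + ?d (- t)))" by (rule ennreal_leI)
    also have "\<dots> = ennreal (1 / \<alpha>) * (ennreal (?d t) + ennreal (?d (- t)))"
      using assms by (subst ennreal_mult) (auto simp: exponential_density_def)
    finally show "ennreal (exp (- \<alpha> * \<bar>t\<bar>)) \<le> \<dots>" .
  qed
  also have "\<dots> = ennreal (1 / \<alpha>) * (1 + 1)"
    using one two by (simp add: nn_integral_cmult nn_integral_add)
  also have "\<dots> < \<infinity>" by (simp add: ennreal_mult_less_top)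
  finally show ?thesis .
qed

text \<open>The origin is inside the convex hull of the points \<open>\<plusminus>\<delta> b\<close>, so the maximum grows linearly: it is at
least \<open>\<delta> * \<bar>y \<bullet> b\<bar> - C\<close> for every basis vector \<open>b\<close>. The mean of these bounds is a sum over the
coordinates, for which the integral factorizes.\<close>

lemma max_affine_mass_cross_polytope_finite:
  fixes F :: "'a::euclidean_space \<Rightarrow> real"
  assumes "\<delta> > 0" and S: "finite S" "(\<lambda>b. \<delta> *\<^sub>R b) ` Basis \<union> (\<lambda>b. - (\<delta> *\<^sub>R b)) ` Basis \<subseteq> S"
  shows "max_affine_mass S F < \<infinity>"
proof -
  define C where "C = Max (F ` S)"
  have FC: "F x \<le> C" if "x \<in> S" for x unfolding C_def using S that by (intro Max_ge) auto
  let ?n = "real DIM('a)"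
  define \<alpha> where "\<alpha> = \<delta> / ?n"
  have \<alpha>: "\<alpha> > 0" using assms by (simp add: \<alpha>_def)
  have bound: "exp (- max_affine S F y) \<le> exp C * (\<Prod>b\<in>Basis. exp (- \<alpha> * \<bar>y \<bullet> b\<bar>))" for y
  proof -
    have "\<delta> * \<bar>y \<bullet> b\<bar> - C \<le> max_affine S F y" if "b \<in> Basis" for b
      using max_affine_ge[OF S(1), of "\<delta> *\<^sub>R b" y F] max_affine_ge[OF S(1), of "- (\<delta> *\<^sub>R b)" y F]
        FC[of "\<delta> *\<^sub>R b"] FC[of "- (\<delta> *\<^sub>R b)"] S(2) that
      by (auto simp: abs_if inner_commute image_subset_iff)
    then have "(\<Sum>b\<in>(Basis::'a set). \<delta> * \<bar>y \<bullet> b\<bar> - C) \<le> (\<Sum>b\<in>(Basis::'a set). max_affine S F y)"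
      by (rule sum_mono)
    then have "\<delta> * (\<Sum>b\<in>(Basis::'a set). \<bar>y \<bullet> b\<bar>) - ?n * C \<le> ?n * max_affine S F y"
      by (simp add: sum_subtractf sum_distrib_left)
    then have "\<alpha> * (\<Sum>b\<in>(Basis::'a set). \<bar>y \<bullet> b\<bar>) - C \<le> max_affine S F y"
      by (simp add: \<alpha>_def field_simps)
    then have "exp (- max_affine S F y) \<le> exp (C + (\<Sum>b\<in>(Basis::'a set). - \<alpha> * \<bar>y \<bullet> b\<bar>))"
      by (simp add: sum_distrib_left[symmetric] sum_negf)
    also have "\<dots> = exp C * (\<Prod>b\<in>Basis. exp (- \<alpha> * \<bar>y \<bullet> b\<bar>))" by (simp add: exp_add exp_sum)
    finally show ?thesis .
  qed
  have "max_affine_mass S F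
      \<le> (\<integral>\<^sup>+y. ennreal (exp C) * (\<Prod>b\<in>(Basis::'a set). ennreal (exp (- \<alpha> * \<bar>y \<bullet> b\<bar>))) \<partial>lborel)"
    unfolding max_affine_mass_def
  proof (rule nn_integral_mono)
    fix y
    show "ennreal (exp (- max_affine S F y))
        \<le> ennreal (exp C) * (\<Prod>b\<in>Basis. ennreal (exp (- \<alpha> * \<bar>y \<bullet> b\<bar>)))"
      using ennreal_leI[OF bound[of y]] by (simp add: prod_ennreal ennreal_mult prod_nonneg)
  qed
  also have "\<dots> = ennreal (exp C) * (\<Prod>b\<in>(Basis::'a set). \<integral>\<^sup>+t. ennreal (exp (- \<alpha> * \<bar>t\<bar>)) \<partial>lborel)"
    using nn_integral_lborel_prod[of "\<lambda>(_::'a) t. ennreal (exp (- \<alpha> * \<bar>t\<bar>))"]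
    by (subst nn_integral_cmult) auto
  also have "\<dots> < \<infinity>"
    using nn_integral_exp_neg_abs_finite[OF \<alpha>]
    by (simp add: ennreal_mult_less_top power_less_top_ennreal)
  finally show ?thesis .
qed

text \<open>Otherwise the domain of \<open>f\<close> lies in a half-space \<open>{x. x \<bullet> a \<le> 0}\<close> with \<open>a \<noteq> 0\<close>. Then \<open>f\<^sup>*\<close> does not
increase in the direction \<open>a\<close>, and its exponential mass is zero or infinite.\<close>

lemma zero_interior_domain:
  fixes f :: "real^'n \<Rightarrow> ereal"
  assumes f: "f \<in> lsc_convex" and mass: "0 < exp_mass (legendre f)" "exp_mass (legendre f) < \<infinity>"
  shows "0 \<in> interior {x. f x \<noteq> \<infinity>}"
proof (rule ccontr)
  let ?D = "{x. f x \<noteq> \<infinity>}"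
  assume no: "0 \<notin> interior ?D"
  have conv: "convex ?D" by (rule convex_domain[OF f])
  have "\<exists>a. a \<noteq> 0 \<and> (\<forall>x\<in>?D. x \<bullet> a \<le> 0)"
  proof (cases "interior ?D = {}")
    case True
    with conv obtain a b where ab: "a \<noteq> 0" "?D \<subseteq> {x. a \<bullet> x = b}"
      by (rule empty_interior_subset_hyperplane)
    show ?thesis
    proof (cases "b \<le> 0")
      case True
      then show ?thesis using ab by (intro exI[of _ a]) (auto simp: inner_commute)
    next
      case False
      then show ?thesis using ab by (intro exI[of _ "- a"]) (auto simp: inner_commute)
    qed
  next
    case False
    obtain a where a: "a \<noteq> 0" "\<forall>x\<in>interior ?D. 0 \<le> a \<bullet> x"
      using separating_hyperplane_set_0[OF convex_interior[OF conv] no] by blast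
    have "closed {x. 0 \<le> a \<bullet> x}" by (intro closed_Collect_le continuous_intros)
    then have "closure (interior ?D) \<subseteq> {x. 0 \<le> a \<bullet> x}" using a by (intro closure_minimal) auto
    moreover have "?D \<subseteq> closure (interior ?D)"
      unfolding convex_closure_interior[OF conv False] by (rule closure_subset)
    ultimately have "?D \<subseteq> {x. 0 \<le> a \<bullet> x}" by (rule order_trans[rotated])
    then show ?thesis using a by (intro exI[of _ "- a"]) (auto simp: inner_commute)
  qed
  then obtain a where a: "a \<noteq> 0" "\<And>x. f x \<noteq> \<infinity> \<Longrightarrow> x \<bullet> a \<le> 0" by auto
  have "legendre f (a + y) \<le> legendre f y" for y
    unfolding legendre_def
  proof (rule SUP_mono')
    fix x
    show "ereal (x \<bullet> (a + y)) - f x \<le> ereal (x \<bullet> y) - f x"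
      using a(2)[of x] by (cases "f x") (auto simp: inner_add_right)
  qed
  then have "exp_mass (legendre f) = 0 \<or> exp_mass (legendre f) = \<infinity>"
    unfolding exp_mass_def using a
    by (intro nn_integral_nondecreasing_along[of _ a])
      (auto intro!: exp_ereal_mono simp: ereal_minus_le_minus)
  with mass show False by auto
qed

text \<open>For every rational \<open>q\<close>, the open set \<open>{y. q < f\<^sup>* y}\<close> is covered by the open sets
\<open>{y. q < x \<bullet> y - f x}\<close>, and countably many points \<open>x\<close> are enough by the Lindelof property.\<close>

lemma legendre_countable_sup:
  fixes f :: "real^'n \<Rightarrow> ereal"
  obtains C where "countable C" "C \<subseteq> {x. f x \<noteq> \<infinity>}"
    "\<And>y t. ereal t < legendre f y \<Longrightarrow> \<exists>x\<in>C. ereal t < ereal (x \<bullet> y) - f x"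
proof -
  let ?D = "{x. f x \<noteq> \<infinity>}"
  define U where "U q x = {y. ereal q < ereal (x \<bullet> y) - f x}" for q :: real and x
  have op: "open (U q x)" for q x
  proof (cases "f x")
    case (real r)
    have "open {y. ereal q < ereal (x \<bullet> y - r)}" by (intro open_Collect_less continuous_intros)
    then show ?thesis using real by (simp add: U_def)
  qed (auto simp: U_def)
  have "\<exists>C. countable C \<and> C \<subseteq> ?D \<and> (\<Union>x\<in>C. U q x) = (\<Union>x\<in>?D. U q x)" for q
  proof -
    obtain \<G> where \<G>: "\<G> \<subseteq> U q ` ?D" "countable \<G>" "\<Union>\<G> = (\<Union>x\<in>?D. U q x)"
      using Lindelof[of "U q ` ?D"] op by auto
    then obtain C where "countable C" "C \<subseteq> ?D" "\<G> = U q ` C"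
      using countable_subset_image[of \<G> "U q" ?D] by auto
    then show ?thesis using \<G>(3) by auto
  qed
  then obtain C where C: "\<And>q. countable (C q)" "\<And>q. C q \<subseteq> ?D" "\<And>q. (\<Union>x\<in>C q. U q x) = (\<Union>x\<in>?D. U q x)"
    by metis
  show thesis
  proof (rule that)
    show "countable (\<Union>q\<in>\<rat>. C q)" using C(1) by (intro countable_UN countable_rat)
    show "(\<Union>q\<in>\<rat>. C q) \<subseteq> ?D" using C(2) by blast
    fix y t assume "ereal t < legendre f y"
    then obtain s where s: "ereal t < ereal s" "ereal s < legendre f y" using ereal_dense2 by blast
    then obtain q where q: "q \<in> \<rat>" "t < q" "q < s" using Rats_dense_in_real[of t s] by auto
    then have "ereal q < legendre f y" using s(2) by (meson ereal_less_eq(3) less_imp_le order_le_less_trans)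
    then obtain x where x: "ereal q < ereal (x \<bullet> y) - f x" by (auto simp: legendre_def less_SUP_iff)
    then have "x \<in> ?D" by auto
    with x have "y \<in> (\<Union>x\<in>C q. U q x)" unfolding C(3) by (auto simp: U_def)
    then obtain x' where "x' \<in> C q" "ereal q < ereal (x' \<bullet> y) - f x'" by (auto simp: U_def)
    moreover then have "ereal t < ereal (x' \<bullet> y) - f x'"
      using q(2) by (meson ereal_less_eq(3) less_imp_le order_le_less_trans)
    ultimately show "\<exists>x\<in>(\<Union>q\<in>\<rat>. C q). ereal t < ereal (x \<bullet> y) - f x" using q(1) by auto
  qed
qed

text \<open>Along an increasing sequence of finite sets that exhausts the countable set of
\<open>legendre_countable_sup\<close>, the functions \<open>exp (- max_affine S F)\<close> decrease to \<open>exp (- f\<^sup>*)\<close>. Starting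
the sequence with the vertices of a cross-polytope inside the domain makes the first integral finite,
so that monotone convergence applies.\<close>

theorem polyhedral_approximation:
  fixes f :: "real^'n \<Rightarrow> ereal"
  assumes f: "f \<in> lsc_convex" and mass: "0 < exp_mass (legendre f)" "exp_mass (legendre f) < ennreal e"
  obtains S where "finite S" "S \<noteq> {}" "S \<subseteq> {x. f x \<noteq> \<infinity>}"
    "max_affine_mass S (\<lambda>x. real_of_ereal (f x)) < ennreal e"
proof -
  let ?D = "{x. f x \<noteq> \<infinity>}" and ?F = "\<lambda>x. real_of_ereal (f x)"
  have nM: "f x \<noteq> -\<infinity>" for x using f by (auto simp: lsc_convex_def)
  have fF: "f x = ereal (?F x)" if "x \<in> ?D" for x using that nM[of x] by (cases "f x") auto
  have "exp_mass (legendre f) < \<infinity>" using mass(2) by (metis infinity_ennreal_def ennreal_less_top order_less_trans)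
  with f mass(1) have "0 \<in> interior ?D" by (intro zero_interior_domain)
  then obtain \<delta> where \<delta>: "\<delta> > 0" "cball 0 \<delta> \<subseteq> ?D" by (auto simp: mem_interior_cball)
  define S0 where "S0 = (\<lambda>b. \<delta> *\<^sub>R b) ` (Basis::(real^'n) set) \<union> (\<lambda>b. - (\<delta> *\<^sub>R b)) ` Basis"
  have S0: "finite S0" "S0 \<noteq> {}" "S0 \<subseteq> ?D"
  proof -
    have "S0 \<subseteq> cball 0 \<delta>" using \<delta>(1) by (auto simp: S0_def)
    with \<delta>(2) show "S0 \<subseteq> ?D" by blast
  qed (auto simp: S0_def)
  obtain C where C: "countable C" "C \<subseteq> ?D"
    "\<And>y t. ereal t < legendre f y \<Longrightarrow> \<exists>x\<in>C. ereal t < ereal (x \<bullet> y) - f x"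
    using legendre_countable_sup[of f] by blast
  define S where "S m = S0 \<union> from_nat_into (C \<union> S0) ` {..m}" for m
  have rng: "range (from_nat_into (C \<union> S0)) = C \<union> S0"
    using C(1) S0 by (intro range_from_nat_into) (auto intro: countable_finite)
  have S: "finite (S m)" "S m \<noteq> {}" "S m \<subseteq> ?D" for m
    using S0 C(2) rng by (auto simp: S_def)
  define \<psi> where "\<psi> m y = ennreal (exp (- max_affine (S m) ?F y))" for m y
  have "decseq \<psi>"
  proof (intro decseq_SucI le_funI)
    fix m y
    have "S m \<subseteq> S (Suc m)" by (auto simp: S_def)
    then show "\<psi> (Suc m) y \<le> \<psi> m y"
      unfolding \<psi>_def using max_affine_mono[OF S(1) _ S(2)] by (intro ennreal_leI) simp
  qed
  have limit: "(INF m. \<psi> m y) \<le> exp_ereal (- legendre f y)" for y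
  proof (rule ccontr)
    assume "\<not> ?thesis"
    then have lt: "exp_ereal (- legendre f y) < (INF m. \<psi> m y)" by simp
    have "(INF m. \<psi> m y) \<le> \<psi> 0 y" by (rule INF_lower) simp
    then have "(INF m. \<psi> m y) \<noteq> \<infinity>" by (auto simp: \<psi>_def top_unique)
    then obtain i where i: "(INF m. \<psi> m y) = ennreal i" "i > 0"
      using lt by (cases "INF m. \<psi> m y") (auto simp: order_le_less)
    have "ereal (- ln i) < legendre f y"
    proof (cases "legendre f y")
      case (real r)
      then have "exp (- r) < i" using lt i by (simp add: ennreal_less_iff)
      then have "ln (exp (- r)) < ln i" using i by (subst ln_less_cancel_iff) auto
      then show ?thesis using real by simp
    next
      case MInf
      then show ?thesis using lt by simp
    qed auto
    then obtain x where x: "x \<in> C" "ereal (- ln i) < ereal (x \<bullet> y) - f x" using C(3) by blast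
    then have "- ln i < x \<bullet> y - ?F x" using C(2) nM[of x] by (cases "f x") auto
    moreover have "x \<in> range (from_nat_into (C \<union> S0))" unfolding rng using x(1) by blast
    then obtain m where "x \<in> S m" by (auto simp: S_def)
    moreover then have "x \<bullet> y - ?F x \<le> max_affine (S m) ?F y" by (intro max_affine_ge S)
    ultimately have "exp (- max_affine (S m) ?F y) < exp (ln i)" by (subst exp_less_cancel_iff) simp
    then have "\<psi> m y < ennreal i" using i by (simp add: \<psi>_def ennreal_lessI)
    moreover have "(INF m. \<psi> m y) \<le> \<psi> m y" by (rule INF_lower) simp
    ultimately show False using i by simp
  qed
  have "(INF m. max_affine_mass (S m) ?F) = (\<integral>\<^sup>+y. (INF m. \<psi> m y) \<partial>lborel)"
    unfolding max_affine_mass_def \<psi>_def[symmetric]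
  proof (rule nn_integral_monotone_convergence_INF_decseq[symmetric])
    show "\<psi> m \<in> borel_measurable lborel" for m
      using borel_measurable_max_affine[OF S(1)[of m]] unfolding \<psi>_def by measurable
    show "(\<integral>\<^sup>+y. \<psi> 0 y \<partial>lborel) < \<infinity>"
      using max_affine_mass_cross_polytope_finite[OF \<delta>(1) S(1)[of 0], of ?F]
      unfolding max_affine_mass_def \<psi>_def by (auto simp: S_def S0_def)
  qed fact
  also have "\<dots> \<le> exp_mass (legendre f)" unfolding exp_mass_def by (intro nn_integral_mono limit)
  also have "\<dots> < ennreal e" by (rule mass)
  finally obtain m where "max_affine_mass (S m) ?F < ennreal e" by (auto simp: INF_less_iff)
  with S show thesis by (intro that[of "S m"])
qed

section \<open>Symmetrized discrete measures\<close>

definition pmf_borel :: "'a::topological_space pmf \<Rightarrow> 'a measure" where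
  "pmf_borel p = distr (measure_pmf p) borel id"

lemma pmf_borel_facts:
  fixes p :: "(real^'n) pmf"
  assumes "finite (set_pmf p)"
  shows "sets (pmf_borel p) = sets borel" "pmf_borel p \<in> prob_compact" "pmf_borel p \<in> prob1"
    "h \<in> borel_measurable borel \<Longrightarrow> (\<integral>x. h x \<partial>pmf_borel p) = measure_pmf.expectation p (h :: _ \<Rightarrow> real)"
    "{x. Q x} \<in> sets borel \<Longrightarrow> (AE x in pmf_borel p. Q x) \<longleftrightarrow> (\<forall>x\<in>set_pmf p. Q x)"
proof -
  have id: "id \<in> measurable (measure_pmf p) borel" by simp
  show s: "sets (pmf_borel p) = sets borel" by (simp add: pmf_borel_def)
  have prob: "prob_space (pmf_borel p)"
    unfolding pmf_borel_def by (rule measure_pmf.prob_space_distr[OF id])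
  have "measure_support (pmf_borel p) \<subseteq> set_pmf p"
  proof
    fix x assume x: "x \<in> measure_support (pmf_borel p)"
    show "x \<in> set_pmf p"
    proof (rule ccontr)
      assume "x \<notin> set_pmf p"
      moreover have "open (- set_pmf p)" using assms by (intro open_Compl finite_imp_closed)
      ultimately have "emeasure (pmf_borel p) (- set_pmf p) > 0" using x by (auto simp: measure_support_def)
      moreover have "emeasure (pmf_borel p) (- set_pmf p) = emeasure (measure_pmf p) (- set_pmf p)"
        unfolding pmf_borel_def using assms
        by (subst emeasure_distr[OF id]) (simp_all add: borel_open open_Compl finite_imp_closed)
      moreover have "measure_pmf.prob p (- set_pmf p) = 0" by (simp add: measure_pmf_zero_iff)
      ultimately show False by (simp add: measure_pmf.emeasure_eq_measure)
    qed
  qed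
  then have "compact (measure_support (pmf_borel p))"
    using assms by (intro finite_imp_compact) (rule finite_subset)
  then show "pmf_borel p \<in> prob_compact" using s prob by (auto simp: prob_compact_def borel_prob_def)
  have "integrable (pmf_borel p) (\<lambda>x. norm x)"
    unfolding pmf_borel_def using assms by (subst integrable_distr_eq[OF id]) (auto intro: integrable_measure_pmf_finite)
  then show "pmf_borel p \<in> prob1" using s prob by (auto simp: prob1_def borel_prob_def)
  show "h \<in> borel_measurable borel \<Longrightarrow> (\<integral>x. h x \<partial>pmf_borel p) = measure_pmf.expectation p h"
    unfolding pmf_borel_def by (subst integral_distr[OF id]) auto
  show "{x. Q x} \<in> sets borel \<Longrightarrow> (AE x in pmf_borel p. Q x) \<longleftrightarrow> (\<forall>x\<in>set_pmf p. Q x)"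
    unfolding pmf_borel_def by (subst AE_distr_iff[OF id]) (auto simp: AE_measure_pmf_iff)
qed

text \<open>The law of \<open>sign_change \<epsilon> x\<close> for \<open>\<epsilon>\<close> uniform in \<open>E\<close> and an independent \<open>x\<close> with law \<open>p\<close>.\<close>

definition sign_mixture :: "('n::finite \<Rightarrow> real) set \<Rightarrow> (real^'n) pmf \<Rightarrow> (real^'n) pmf" where
  "sign_mixture E p = bind_pmf (pmf_of_set E) (\<lambda>\<epsilon>. map_pmf (sign_change \<epsilon>) p)"

lemma set_sign_mixture:
  assumes "sign_group E"
  shows "set_pmf (sign_mixture E p) = (\<Union>\<epsilon>\<in>E. sign_change \<epsilon> ` set_pmf p)"
  using sign_group_finite[OF assms] by (simp add: sign_mixture_def set_pmf_of_set)

text \<open>Multiplication by \<open>\<delta>\<close> permutes the group and preserves its uniform distribution.\<close>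

lemma map_sign_mixture:
  fixes E :: "('n::finite \<Rightarrow> real) set"
  assumes E: "sign_group E" and \<delta>: "\<delta> \<in> E"
  shows "map_pmf (sign_change \<delta>) (sign_mixture E p) = sign_mixture E p"
proof -
  let ?m = "\<lambda>\<epsilon> i. \<delta> i * \<epsilon> i"
  have sq: "\<delta> i * \<delta> i = 1" for i by (rule sign_square[OF sign_group_signs[OF E \<delta>]])
  have inv: "?m (?m \<epsilon>) = \<epsilon>" for \<epsilon> by (simp add: sq mult.assoc[symmetric])
  have inj: "inj_on ?m E" by (rule inj_on_inverseI[of _ ?m]) (rule inv)
  have sub: "?m ` E \<subseteq> E" using E \<delta> by (auto simp: sign_group_def)
  have "?m ` E = E"
  proof
    show "E \<subseteq> ?m ` E"
    proof
      fix \<epsilon> assume "\<epsilon> \<in> E"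
      then have "?m \<epsilon> \<in> E" using sub by blast
      then have "?m (?m \<epsilon>) \<in> ?m ` E" by (rule imageI)
      then show "\<epsilon> \<in> ?m ` E" unfolding inv .
    qed
  qed (rule sub)
  then have unif: "map_pmf ?m (pmf_of_set E) = pmf_of_set E"
    using map_pmf_of_set_inj[OF inj] sign_group_finite[OF E] by simp
  have "map_pmf (sign_change \<delta>) (sign_mixture E p)
      = bind_pmf (pmf_of_set E) (\<lambda>\<epsilon>. map_pmf (sign_change (?m \<epsilon>)) p)"
    unfolding sign_mixture_def map_bind_pmf
    by (simp add: map_pmf_comp sign_change_sign_change o_def)
  also have "\<dots> = bind_pmf (map_pmf ?m (pmf_of_set E)) (\<lambda>\<epsilon>. map_pmf (sign_change \<epsilon>) p)"
    by (simp add: bind_map_pmf)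
  finally show ?thesis unfolding unif sign_mixture_def .
qed

lemma pmf_borel_sign_mixture_inv:
  fixes E :: "('n::finite \<Rightarrow> real) set"
  assumes E: "sign_group E" and p: "finite (set_pmf p)"
  shows "pmf_borel (sign_mixture E p) \<in> prob1_inv E"
proof -
  have "finite (set_pmf (sign_mixture E p))"
    using p sign_group_finite[OF E] by (auto simp: set_sign_mixture[OF E])
  then have "pmf_borel (sign_mixture E p) \<in> prob1" by (rule pmf_borel_facts)
  moreover have "distr (pmf_borel q) borel (sign_change \<delta>) = pmf_borel (map_pmf (sign_change \<delta>) q)"
    for \<delta> and q :: "(real^'n) pmf"
    unfolding pmf_borel_def map_pmf_rep_eq by (simp add: distr_distr o_def)
  ultimately show ?thesis using map_sign_mixture[OF E] by (auto simp: prob1_inv_def)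
qed

lemma expectation_sign_mixture:
  fixes h :: "real^'n \<Rightarrow> real"
  assumes E: "sign_group E" and p: "finite (set_pmf p)"
  shows "real (card E) * measure_pmf.expectation (sign_mixture E p) h
    = (\<Sum>\<epsilon>\<in>E. measure_pmf.expectation p (\<lambda>x. h (sign_change \<epsilon> x)))"
proof -
  have "real (card E) \<noteq> 0" using sign_group_finite[OF E] by simp
  then show ?thesis
    using sign_group_finite[OF E] p unfolding sign_mixture_def
    by (subst pmf_expectation_bind_pmf_of_set) (simp_all add: sum_distrib_left mult.assoc[symmetric])
qed

section \<open>From the transport inequality to the reverse Santalo inequality\<close>

text \<open>Let \<open>p\<close> be the tangent measure of \<open>max_affine_mass_tangent\<close> at the restriction of \<open>f\<close> to a finite
set, and \<open>\<nu>\<close> its average over the group. For a competitor \<open>h\<close> the tangent inequality holds for each of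
the functions \<open>x \<mapsto> h (sign_change \<epsilon> x)\<close>, whose transforms all have the same exponential mass;
averaging these inequalities gives the claim for \<open>\<nu>\<close>, as \<open>f\<close> has the same integral with respect to \<open>p\<close>
and \<open>\<nu>\<close>.\<close>

theorem K_Leb_upper_bound:
  fixes E :: "('n::finite \<Rightarrow> real) set"
  assumes E: "sign_group E" and f: "f \<in> lsc_convex_inv E"
    and mass: "0 < exp_mass (legendre f)" "exp_mass (legendre f) < ennreal (exp \<eta>)"
  obtains \<nu> r where "\<nu> \<in> prob_compact" "\<nu> \<in> prob1_inv E"
    "ereal_integral \<nu> f = ereal r" "K_Leb \<nu> \<le> ereal (\<eta> - r)"
proof -
  let ?F = "\<lambda>x. real_of_ereal (f x)"
  have lsc: "f \<in> lsc_convex" and inv: "\<And>\<epsilon> x. \<epsilon> \<in> E \<Longrightarrow> f (sign_change \<epsilon> x) = f x"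
    using f by (auto simp: lsc_convex_inv_def)
  have nM: "f x \<noteq> -\<infinity>" for x using lsc by (auto simp: lsc_convex_def)
  have [measurable]: "f \<in> borel_measurable borel" by (rule lsc_convex_measurable[OF lsc])
  obtain S where S: "finite S" "S \<noteq> {}" "S \<subseteq> {x. f x \<noteq> \<infinity>}" "max_affine_mass S ?F < ennreal (exp \<eta>)"
    using polyhedral_approximation[OF lsc mass] by blast
  obtain z where z: "max_affine_mass S ?F = ennreal z" "z > 0"
    using S(4) max_affine_mass_pos[OF S(1), of ?F]
    by (cases "max_affine_mass S ?F") (auto simp: order_le_less)
  have "z < exp \<eta>" using S(4) z by (simp add: ennreal_less_iff)
  then have "ln z < ln (exp \<eta>)" using z(2) by (subst ln_less_cancel_iff) auto
  then have z_le: "ln z \<le> \<eta>" by simp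
  obtain p where p: "set_pmf p \<subseteq> S"
    "\<And>b. max_affine_mass (set_pmf p) b \<le> ennreal (z * exp (\<Sum>x\<in>set_pmf p. pmf p x * (b x - ?F x)))"
    using max_affine_mass_tangent[OF S(1,2) z] by blast
  have finp: "finite (set_pmf p)" using p(1) S(1) by (rule finite_subset)
  define q where "q = sign_mixture E p"
  define \<nu> where "\<nu> = pmf_borel q"
  have setq: "set_pmf q = (\<Union>\<epsilon>\<in>E. sign_change \<epsilon> ` set_pmf p)"
    unfolding q_def by (rule set_sign_mixture[OF E])
  have finq: "finite (set_pmf q)" using finp sign_group_finite[OF E] by (simp add: setq)
  note \<nu> = pmf_borel_facts[OF finq, folded \<nu>_def]
  have [measurable_cong]: "sets \<nu> = sets borel" by (rule \<nu>(1))
  let ?N = "real (card E)"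
  have N: "?N > 0" using sign_group_finite[OF E] by (simp add: card_gt_0_iff)
  have Eq: "?N * measure_pmf.expectation q h = (\<Sum>\<epsilon>\<in>E. measure_pmf.expectation p (\<lambda>x. h (sign_change \<epsilon> x)))"
    for h :: "real^'n \<Rightarrow> real"
    unfolding q_def by (rule expectation_sign_mixture[OF E finp])
  have fq: "f x \<noteq> \<infinity>" if "x \<in> set_pmf q" for x
    using that p(1) S(3) inv by (auto simp: setq)
  define r where "r = measure_pmf.expectation q ?F"
  have r: "r = measure_pmf.expectation p ?F"
    using Eq[of ?F] inv N by (simp add: r_def)
  have Ep: "measure_pmf.expectation p h = (\<Sum>x\<in>set_pmf p. pmf p x * h x)" for h :: "real^'n \<Rightarrow> real"
    by (subst integral_measure_pmf_real[OF finp]) (auto simp: mult.commute)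
  have intF: "integrable \<nu> ?F"
    unfolding \<nu>_def pmf_borel_def by (subst integrable_distr_eq) (auto intro: integrable_measure_pmf_finite finq)
  have "AE x in \<nu>. ereal (?F x) \<le> f x \<and> f x \<le> ereal (?F x)"
  proof (subst \<nu>(5))
    show "{x. ereal (?F x) \<le> f x \<and> f x \<le> ereal (?F x)} \<in> sets borel" by measurable
    show "\<forall>x\<in>set_pmf q. ereal (?F x) \<le> f x \<and> f x \<le> ereal (?F x)"
      using fq nM by (auto simp: ereal_real)
  qed
  then have "f \<in> ereal_L1 \<nu>" using intF by (intro ereal_L1_sandwich[of _ _ ?F ?F]) auto
  then have integral_f: "ereal_integral \<nu> f = ereal r"
    by (simp add: ereal_L1_integrable(3) \<nu>(4) r_def)
  have "K_Leb \<nu> \<le> ereal (\<eta> - r)"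
    unfolding K_Leb_def
  proof (rule SUP_least)
    fix h assume h: "h \<in> ereal_L1 \<nu> \<inter> lsc_convex"
    let ?H = "\<lambda>x. real_of_ereal (h x)"
    have [measurable]: "h \<in> borel_measurable borel" using h lsc_convex_measurable by blast
    have "AE x in \<nu>. h x \<noteq> \<infinity> \<and> h x \<noteq> -\<infinity>" using h ereal_L1_integrable(1) by blast
    then have hq: "h x = ereal (?H x)" if "x \<in> set_pmf q" for x
      using that by (subst (asm) \<nu>(5)) (auto simp: ereal_real)
    have int_h: "ereal_integral \<nu> (\<lambda>x. - h x) = ereal (- measure_pmf.expectation q ?H)"
      using h by (simp add: ereal_L1_integrable(4) \<nu>(4))
    have log_z: "log_ennreal (ennreal (z * exp t)) = ereal (ln z + t)" for t
    proof -
      have "z * exp t > 0" using z(2) by simp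
      then show ?thesis using z(2) by (simp add: log_ennreal_def ln_mult ennreal_eq_0_iff not_le)
    qed
    have log_le: "log_ennreal (exp_mass (legendre h))
        \<le> ereal (ln z + measure_pmf.expectation p (\<lambda>x. ?H (sign_change \<epsilon> x)) - r)" if \<epsilon>: "\<epsilon> \<in> E" for \<epsilon>
    proof -
      let ?k = "\<lambda>x. h (sign_change \<epsilon> x)"
      have "exp_mass (legendre ?k) \<le> max_affine_mass (set_pmf p) (\<lambda>x. real_of_ereal (?k x))"
        unfolding exp_mass_def max_affine_mass_def
      proof (rule nn_integral_mono)
        fix y
        let ?m = "max_affine (set_pmf p) (\<lambda>x. real_of_ereal (?k x)) y"
        have "ereal ?m \<le> legendre ?k y"
        proof -
          have "?m \<in> (\<lambda>x. x \<bullet> y - real_of_ereal (?k x)) ` set_pmf p"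
            unfolding max_affine_def using finp set_pmf_not_empty by (intro Max_in) auto
          then obtain x where x: "x \<in> set_pmf p" "?m = x \<bullet> y - real_of_ereal (?k x)" by blast
          then have "?k x = ereal (real_of_ereal (?k x))" using \<epsilon> by (intro hq) (auto simp: setq)
          then obtain s where "?k x = ereal s" by blast
          with x(2) have "ereal ?m = ereal (x \<bullet> y) - ?k x" by simp
          then show ?thesis using fenchel_young[of x y ?k] by simp
        qed
        then have "exp_ereal (- legendre ?k y) \<le> exp_ereal (- ereal ?m)"
          by (intro exp_ereal_mono) (simp only: ereal_minus_le_minus)
        then show "exp_ereal (- legendre ?k y) \<le> ennreal (exp (- ?m))" by simp
      qed
      also have "\<dots> \<le> ennreal (z * exp (\<Sum>x\<in>set_pmf p. pmf p x * (real_of_ereal (?k x) - ?F x)))"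
        by (rule p(2))
      also have "(\<Sum>x\<in>set_pmf p. pmf p x * (real_of_ereal (?k x) - ?F x))
          = measure_pmf.expectation p (\<lambda>x. ?H (sign_change \<epsilon> x)) - r"
        by (simp add: r Ep right_diff_distrib sum_subtractf)
      finally have "exp_mass (legendre h)
          \<le> ennreal (z * exp (measure_pmf.expectation p (\<lambda>x. ?H (sign_change \<epsilon> x)) - r))"
        unfolding exp_mass_legendre_sign_change[OF sign_group_signs[OF E \<epsilon>]] .
      then have "log_ennreal (exp_mass (legendre h))
          \<le> log_ennreal (ennreal (z * exp (measure_pmf.expectation p (\<lambda>x. ?H (sign_change \<epsilon> x)) - r)))"
        by (rule log_ennreal_mono)
      then show ?thesis unfolding log_z by (simp add: algebra_simps)
    qed
    show "ereal_integral \<nu> (\<lambda>x. - h x) + log_ennreal (exp_mass (legendre h)) \<le> ereal (\<eta> - r)"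
    proof (cases "log_ennreal (exp_mass (legendre h))")
      case (real l)
      have "(\<Sum>\<epsilon>\<in>E. l) \<le> (\<Sum>\<epsilon>\<in>E. ln z - r + measure_pmf.expectation p (\<lambda>x. ?H (sign_change \<epsilon> x)))"
        using log_le real by (intro sum_mono) (auto simp: algebra_simps)
      then have "?N * l \<le> ?N * (ln z - r) + ?N * measure_pmf.expectation q ?H"
        unfolding Eq by (simp add: sum.distrib)
      then have "?N * l \<le> ?N * (ln z - r + measure_pmf.expectation q ?H)" by (simp add: distrib_left)
      then have "l \<le> ln z - r + measure_pmf.expectation q ?H" using N by simp
      then show ?thesis using z_le unfolding int_h real by simp
    next
      case PInf
      then show ?thesis using log_le sign_group_finite[OF E] by auto
    next
      case MInf
      then show ?thesis unfolding int_h by simp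
    qed
  qed
  with that[of \<nu> r] \<nu>(2) integral_f pmf_borel_sign_mixture_inv[OF E finp] show thesis
    by (simp add: \<nu>_def q_def)
qed

text \<open>The measures of \<open>K_Leb_upper_bound\<close> for \<open>f\<close> and for \<open>f\<^sup>*\<close>, together with the competitor \<open>f\<close> in the
transport cost, make the hypothesis read \<open>n log c \<le> log (m f) + log (m f\<^sup>*) + \<delta>\<close>: the integrals of
\<open>f\<close> and \<open>f\<^sup>*\<close> cancel.\<close>

theorem reverse_santalo_if_entropy_transport_ineq:
  fixes E :: "('n::finite \<Rightarrow> real) set"
  assumes E: "sign_group E" and c: "c > 0"
    and ineq: "\<And>\<nu>\<^sub>1 \<nu>\<^sub>2. \<nu>\<^sub>1 \<in> prob_compact \<inter> prob1_inv E \<Longrightarrow> \<nu>\<^sub>2 \<in> prob_compact \<inter> prob1_inv E \<Longrightarrow>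
      entropy_transport_ineq c \<nu>\<^sub>1 \<nu>\<^sub>2"
  shows "reverse_santalo (lsc_convex_inv E) c"
  unfolding reverse_santalo_def
proof (intro ballI impI)
  fix f :: "real^'n \<Rightarrow> ereal"
  assume f: "f \<in> lsc_convex_inv E" and pos: "0 < exp_mass f \<and> 0 < exp_mass (legendre f)"
  show "exp_mass f * exp_mass (legendre f) \<ge> ennreal (c ^ CARD('n))"
  proof (cases "exp_mass f = \<infinity> \<or> exp_mass (legendre f) = \<infinity>")
    case True
    then have "exp_mass f * exp_mass (legendre f) = \<infinity>"
      using pos by (auto simp: ennreal_mult_eq_top_iff)
    then show ?thesis by simp
  next
    case False
    then obtain A B where A: "exp_mass f = ennreal A" "A > 0" and B: "exp_mass (legendre f) = ennreal B" "B > 0"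
      using pos by (metis ennreal_cases ennreal_0 infinity_ennreal_def less_irrefl order_le_less)
    have lsc: "f \<in> lsc_convex" and inv: "\<And>\<epsilon> x. \<epsilon> \<in> E \<Longrightarrow> f (sign_change \<epsilon> x) = f x"
      using f by (auto simp: lsc_convex_inv_def)
    obtain x0 where x0: "f x0 \<noteq> \<infinity>" using lsc by (auto simp: lsc_convex_def)
    obtain y0 where y0: "legendre f y0 \<noteq> \<infinity>"
    proof -
      have "\<exists>y. legendre f y \<noteq> \<infinity>"
      proof (rule ccontr)
        assume "\<not> ?thesis"
        then have "exp_mass (legendre f) = 0" by (simp add: exp_mass_def)
        with pos show False by simp
      qed
      then show ?thesis using that by blast
    qed
    have biconj: "legendre (legendre f) = f" by (rule fenchel_moreau[OF lsc y0])
    have Lf: "legendre f \<in> lsc_convex_inv E"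
      using legendre_in_lsc_convex[of f x0 y0] x0 y0 legendre_inv[OF E, of f] inv
      by (auto simp: lsc_convex_inv_def)
    let ?C = "real CARD('n) * ln c"
    have "?C \<le> (ln A + ln B) + \<delta>" if \<delta>: "\<delta> > 0" for \<delta>
    proof -
      have lt: "ennreal a < ennreal (exp (ln a + \<delta> / 2))" if "a > 0" for a
        using that \<delta> by (intro ennreal_lessI) (auto simp: exp_add)
      obtain \<nu>\<^sub>1 r1 where 1: "\<nu>\<^sub>1 \<in> prob_compact" "\<nu>\<^sub>1 \<in> prob1_inv E"
        "ereal_integral \<nu>\<^sub>1 f = ereal r1" "K_Leb \<nu>\<^sub>1 \<le> ereal (ln B + \<delta> / 2 - r1)"
        using K_Leb_upper_bound[OF E f, of "ln B + \<delta> / 2"] pos B lt[of B] by metis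
      obtain \<nu>\<^sub>2 r2 where 2: "\<nu>\<^sub>2 \<in> prob_compact" "\<nu>\<^sub>2 \<in> prob1_inv E"
        "ereal_integral \<nu>\<^sub>2 (legendre f) = ereal r2" "K_Leb \<nu>\<^sub>2 \<le> ereal (ln A + \<delta> / 2 - r2)"
        using K_Leb_upper_bound[OF E Lf, of "ln A + \<delta> / 2"] pos A lt[of A] unfolding biconj by metis
      have "transport \<nu>\<^sub>1 \<nu>\<^sub>2 \<le> ereal_integral \<nu>\<^sub>1 f + ereal_integral \<nu>\<^sub>2 (legendre f)"
        unfolding transport_def using lsc by (rule INF_lower)
      then have T: "transport \<nu>\<^sub>1 \<nu>\<^sub>2 \<le> ereal (r1 + r2)" using 1 2 by simp
      have "ereal ?C - transport \<nu>\<^sub>1 \<nu>\<^sub>2 \<le> K_Leb \<nu>\<^sub>1 + K_Leb \<nu>\<^sub>2"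
        using ineq[of \<nu>\<^sub>1 \<nu>\<^sub>2] 1 2 by (simp add: entropy_transport_ineq_def)
      also have "\<dots> \<le> ereal (ln B + \<delta> / 2 - r1) + ereal (ln A + \<delta> / 2 - r2)"
        using 1 2 by (intro add_mono)
      finally show ?thesis using T by (cases "transport \<nu>\<^sub>1 \<nu>\<^sub>2") auto
    qed
    then have "?C \<le> ln A + ln B" by (rule field_le_epsilon)
    then have "ln (c ^ CARD('n)) \<le> ln (A * B)" using c A B by (simp add: ln_realpow ln_mult)
    then have "c ^ CARD('n) \<le> A * B" using c A B by simp
    then show ?thesis using A B by (simp add: ennreal_mult[symmetric] ennreal_leI)
  qed
qed

section \<open>Compactly supported measures and the three symmetry classes\<close>

text \<open>By the Lindelof property the complement of the support is a countable union of open null sets, so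
almost every point lies in the support, which is bounded.\<close>

lemma prob_compact_subset_prob1: "prob_compact \<subseteq> prob1"
proof
  fix \<nu> :: "(real^'n) measure" assume \<nu>: "\<nu> \<in> prob_compact"
  then have s[measurable_cong]: "sets \<nu> = sets borel" and prob: "prob_space \<nu>"
    and comp: "compact (measure_support \<nu>)"
    by (auto simp: prob_compact_def borel_prob_def)
  interpret prob_space \<nu> by (rule prob)
  define \<U> where "\<U> = {U. open U \<and> emeasure \<nu> U = 0}"
  obtain \<V> where \<V>: "\<V> \<subseteq> \<U>" "countable \<V>" "\<Union>\<V> = \<Union>\<U>"
    using Lindelof[of \<U>] by (auto simp: \<U>_def)
  have "\<Union>\<V> \<in> null_sets \<nu>"
    using \<V>(1,2) by (intro null_sets_UN'[of \<V> "\<lambda>x. x", simplified]) (auto simp: \<U>_def null_sets_def s)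
  moreover have "- measure_support \<nu> \<subseteq> \<Union>\<U>" by (auto simp: measure_support_def \<U>_def not_gr_zero)
  ultimately have "AE x in \<nu>. x \<in> measure_support \<nu>"
    using \<V>(3) by (intro AE_I'[of "\<Union>\<V>"]) auto
  moreover obtain R where "\<And>x. x \<in> measure_support \<nu> \<Longrightarrow> norm x \<le> R"
    using compact_imp_bounded[OF comp] by (auto simp: bounded_iff)
  ultimately have "AE x in \<nu>. norm (norm x) \<le> R" by (auto elim: eventually_mono)
  then have "integrable \<nu> (\<lambda>x. norm x)" by (intro integrable_const_bound) auto
  with s prob show "\<nu> \<in> prob1" by (auto simp: prob1_def borel_prob_def)
qed

theorem reverse_santalo_iff_entropy_transport_ineq:
  fixes E :: "('n::finite \<Rightarrow> real) set"
  assumes E: "sign_group E" and c: "c > 0"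
  shows "reverse_santalo (lsc_convex_inv E) c \<longleftrightarrow>
      (\<forall>\<nu>\<^sub>1\<in>prob1_inv E. \<forall>\<nu>\<^sub>2\<in>prob1_inv E. entropy_transport_ineq c \<nu>\<^sub>1 \<nu>\<^sub>2)"
    and "reverse_santalo (lsc_convex_inv E) c \<longleftrightarrow>
      (\<forall>\<nu>\<^sub>1\<in>prob_compact \<inter> prob1_inv E. \<forall>\<nu>\<^sub>2\<in>prob_compact \<inter> prob1_inv E. entropy_transport_ineq c \<nu>\<^sub>1 \<nu>\<^sub>2)"
  using entropy_transport_ineq_if_reverse_santalo[OF E c] reverse_santalo_if_entropy_transport_ineq[OF E c]
  by blast+

lemma sign_group_trivial: "sign_group {\<lambda>_. 1}"
  by (auto simp: sign_group_def)

lemma sign_group_reflection: "sign_group {\<lambda>_. 1, \<lambda>_. -1}"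
  by (auto simp: sign_group_def)

lemma sign_group_all: "sign_group (UNIV \<rightarrow> {-1, 1})"
proof -
  have "a * b \<in> {-1, 1}" if "a \<in> {-1, 1}" "b \<in> {-1, 1}" for a b :: real using that by auto
  then show ?thesis unfolding sign_group_def by (auto simp: Pi_iff)
qed

lemma sign_change_1: "sign_change (\<lambda>_. 1) = (\<lambda>x. x)"
  by (auto simp: sign_change_def fun_eq_iff vec_eq_iff)

lemma sign_change_minus_1: "sign_change (\<lambda>_. -1) = uminus"
  by (auto simp: sign_change_def fun_eq_iff vec_eq_iff)

lemma distr_prob1_id: "\<nu> \<in> prob1 \<Longrightarrow> distr \<nu> borel (\<lambda>x. x) = \<nu>"
  using prob1D(1) by (intro distr_id2) auto

lemma lsc_convex_inv_classes:
  "lsc_convex_inv {\<lambda>_. 1} = lsc_convex" "lsc_convex_inv {\<lambda>_. 1, \<lambda>_. -1} = lsc_convex_sym"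
  "lsc_convex_inv (UNIV \<rightarrow> {-1, 1}) = lsc_convex_uncond"
  by (auto simp: lsc_convex_inv_def lsc_convex_sym_def lsc_convex_uncond_def sign_change_1 sign_change_minus_1)

lemma prob1_inv_classes:
  "prob1_inv {\<lambda>_. 1} = prob1" "prob1_inv {\<lambda>_. 1, \<lambda>_. -1} = prob1_sym"
  "prob1_inv (UNIV \<rightarrow> {-1, 1}) = prob1_uncond"
  by (auto simp: prob1_inv_def prob1_sym_def prob1_uncond_def sign_change_1 sign_change_minus_1 distr_prob1_id)

theorem theorem5:
  fixes c :: real
  assumes "c > 0"
  shows
    "(reverse_santalo (lsc_convex :: (real^'n \<Rightarrow> ereal) set) c \<longleftrightarrow>
        (\<forall>\<nu>\<^sub>1 \<in> (prob1 :: (real^'n) measure set). \<forall>\<nu>\<^sub>2 \<in> prob1. entropy_transport_ineq c \<nu>\<^sub>1 \<nu>\<^sub>2))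
   \<and> (reverse_santalo (lsc_convex :: (real^'n \<Rightarrow> ereal) set) c \<longleftrightarrow>
        (\<forall>\<nu>\<^sub>1 \<in> (prob_compact :: (real^'n) measure set). \<forall>\<nu>\<^sub>2 \<in> prob_compact.
           entropy_transport_ineq c \<nu>\<^sub>1 \<nu>\<^sub>2))
   \<and> (reverse_santalo (lsc_convex_uncond :: (real^'n \<Rightarrow> ereal) set) c \<longleftrightarrow>
        (\<forall>\<nu>\<^sub>1 \<in> (prob1_uncond :: (real^'n) measure set). \<forall>\<nu>\<^sub>2 \<in> prob1_uncond.
           entropy_transport_ineq c \<nu>\<^sub>1 \<nu>\<^sub>2))
   \<and> (reverse_santalo (lsc_convex_uncond :: (real^'n \<Rightarrow> ereal) set) c \<longleftrightarrow>
        (\<forall>\<nu>\<^sub>1 \<in> (prob_compact \<inter> prob1_uncond :: (real^'n) measure set).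
           \<forall>\<nu>\<^sub>2 \<in> prob_compact \<inter> prob1_uncond. entropy_transport_ineq c \<nu>\<^sub>1 \<nu>\<^sub>2))
   \<and> (reverse_santalo (lsc_convex_sym :: (real^'n \<Rightarrow> ereal) set) c \<longleftrightarrow>
        (\<forall>\<nu>\<^sub>1 \<in> (prob1_sym :: (real^'n) measure set). \<forall>\<nu>\<^sub>2 \<in> prob1_sym.
           entropy_transport_ineq c \<nu>\<^sub>1 \<nu>\<^sub>2))
   \<and> (reverse_santalo (lsc_convex_sym :: (real^'n \<Rightarrow> ereal) set) c \<longleftrightarrow>
        (\<forall>\<nu>\<^sub>1 \<in> (prob_compact \<inter> prob1_sym :: (real^'n) measure set).
           \<forall>\<nu>\<^sub>2 \<in> prob_compact \<inter> prob1_sym. entropy_transport_ineq c \<nu>\<^sub>1 \<nu>\<^sub>2))"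
proof -
  have "prob_compact \<inter> prob1 = (prob_compact :: (real^'n) measure set)"
    using prob_compact_subset_prob1 by blast
  then show ?thesis
    using reverse_santalo_iff_entropy_transport_ineq[OF sign_group_trivial assms, where ?'n = 'n]
      reverse_santalo_iff_entropy_transport_ineq[OF sign_group_all assms, where ?'n = 'n]
      reverse_santalo_iff_entropy_transport_ineq[OF sign_group_reflection assms, where ?'n = 'n]
    unfolding lsc_convex_inv_classes prob1_inv_classes by simp
qed

end
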